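(* The Resco-Small algebra $R$ (an algebra over the field $k$, both defined in the context) has no finite-dimensional filtration $\mathcal{F}$ over $k$ whose associated graded algebra $\operatorname{gr}_{\mathcal{F}}(R)$ is Noetherian.
   Context: The Resco-Small algebra: let $p$ be a prime number, let $K=\mathbb{F}_p(t_0,t_1,t_2,\dots)$ be the field of rational functions over $\mathbb{F}_p$ in countably many algebraically independent variables, let $\delta\colon K\to K$ be the derivation determined by $\delta(t_i)=t_{i+1}$ for all $i\geq 0$, and let $k=K^p=\mathbb{F}_p(t_0^p,t_1^p,\dots)$, so that $k\subseteq\ker\delta$. The Resco-Small algebra is the differential polynomial ring $R=K[x;\delta]$ (polynomials in $x$ with coefficients in $K$ and multiplication determined by $xa=ax+\delta(a)$ for $a\in K$), regarded as an algebra over the central subfield $k$. Noetherian means left and right Noetherian. A finite-dimensional filtration of a $k$-algebra $R$ is an ascending chain of $k$-subspaces $k\subseteq \mathcal{F}_0\subseteq \mathcal{F}_1\subseteq\cdots$ of $R$ such that $\dim_k\mathcal{F}_i<\infty$ and $\mathcal{F}_i\mathcal{F}_j\subseteq\mathcal{F}_{i+j}$ for all $i,j\geq 0$; all filtrations are assumed exhaustive, i.e. $R=\bigcup_{i\geq 0}\mathcal{F}_i$. The associated graded algebra is $\operatorname{gr}_{\mathcal{F}}(R)=\mathcal{F}_0\oplus\mathcal{F}_1/\mathcal{F}_0\oplus\mathcal{F}_2/\mathcal{F}_1\oplus\cdots$ with the induced multiplication. *)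

theory Defs
  imports
    "Berlekamp_Zassenhaus.Finite_Field"
    "HOL-Library.Poly_Mapping"
    "HOL-Computational_Algebra.Fraction_Field"
    "HOL-Computational_Algebra.Polynomial"
    "HOL-Algebra.Embedded_Algebras"
begin

section \<open>Noetherian rings\<close>

text \<open>
  \<^const>\<open>ideal\<close> is two-sided; the rings here are noncommutative, so one-sided ideals are needed.
\<close>

definition left_ideal :: "'a set \<Rightarrow> ('a, 'b) ring_scheme \<Rightarrow> bool" where
  "left_ideal I R \<longleftrightarrow> additive_subgroup I R \<and> (\<forall>r \<in> carrier R. \<forall>a \<in> I. r \<otimes>\<^bsub>R\<^esub> a \<in> I)"

definition right_ideal :: "'a set \<Rightarrow> ('a, 'b) ring_scheme \<Rightarrow> bool" where
  "right_ideal I R \<longleftrightarrow> additive_subgroup I R \<and> (\<forall>r \<in> carrier R. \<forall>a \<in> I. a \<otimes>\<^bsub>R\<^esub> r \<in> I)"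

definition ascending_chain_condition :: "('a set \<Rightarrow> bool) \<Rightarrow> bool" where
  "ascending_chain_condition P \<longleftrightarrow> (\<forall>I :: nat \<Rightarrow> 'a set. (\<forall>n. P (I n) \<and> I n \<subseteq> I (Suc n)) \<longrightarrow> (\<exists>N. \<forall>n\<ge>N. I n = I N))"

definition left_noetherian :: "('a, 'b) ring_scheme \<Rightarrow> bool" where
  "left_noetherian R \<longleftrightarrow> ascending_chain_condition (\<lambda>I. left_ideal I R)"

definition right_noetherian :: "('a, 'b) ring_scheme \<Rightarrow> bool" where
  "right_noetherian R \<longleftrightarrow> ascending_chain_condition (\<lambda>I. right_ideal I R)"

definition noetherian :: "('a, 'b) ring_scheme \<Rightarrow> bool" where
  "noetherian R \<longleftrightarrow> left_noetherian R \<and> right_noetherian R"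


section \<open>Finite-dimensional filtrations and associated graded rings\<close>

text \<open>
  \<^const>\<open>subalgebra\<close> \<open>k V R\<close> says that \<open>V\<close> is a \<open>k\<close>-subspace of \<open>R\<close>; despite its name it does not
  require closure under multiplication.
\<close>

definition fd_filtration :: "('a, 'b) ring_scheme \<Rightarrow> 'a set \<Rightarrow> (nat \<Rightarrow> 'a set) \<Rightarrow> bool" where
  "fd_filtration R k F \<longleftrightarrow>
     k \<subseteq> F 0 \<and>
     (\<forall>i. F i \<subseteq> F (Suc i)) \<and>
     (\<forall>i. subalgebra k (F i) R \<and> ring.finite_dimension R k (F i)) \<and>
     (\<forall>i j. \<forall>a \<in> F i. \<forall>b \<in> F j. a \<otimes>\<^bsub>R\<^esub> b \<in> F (i + j)) \<and>
     (\<Union>i. F i) = carrier R"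

text \<open>The member of the filtration preceding \<open>F n\<close>, where \<open>F (-1) = 0\<close>.\<close>

definition prev_fil :: "('a, 'b) ring_scheme \<Rightarrow> (nat \<Rightarrow> 'a set) \<Rightarrow> nat \<Rightarrow> 'a set" where
  "prev_fil R F n = (case n of 0 \<Rightarrow> {\<zero>\<^bsub>R\<^esub>} | Suc m \<Rightarrow> F m)"

definition gr_component :: "('a, 'b) ring_scheme \<Rightarrow> (nat \<Rightarrow> 'a set) \<Rightarrow> nat \<Rightarrow> 'a set set" where
  "gr_component R F n = (\<lambda>a. prev_fil R F n +>\<^bsub>R\<^esub> a) ` F n"

text \<open>
  An element of the direct sum of the quotients \<open>F n / F (n - 1)\<close> is the family of its homogeneous
  components, each of them a coset, all but finitely many of them zero.  In degree \<open>n\<close> the product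
  is the sum over \<open>i + j = n\<close> of the products
  \<open>(a + F (i - 1)) (b + F (j - 1)) = a b + F (i + j - 1)\<close>.  As in \<^const>\<open>rcoset_mult\<close>, the union over
  all representatives avoids a choice: all its members coincide when \<open>F\<close> is a filtration.
\<close>

definition assoc_graded :: "('a, 'b) ring_scheme \<Rightarrow> (nat \<Rightarrow> 'a set) \<Rightarrow> (nat \<Rightarrow> 'a set) ring" where
  "assoc_graded R F =
     \<lparr> carrier = {u. (\<forall>n. u n \<in> gr_component R F n) \<and> finite {n. u n \<noteq> prev_fil R F n}},
       monoid.mult = (\<lambda>u v n. \<Union>a \<in> Pi {..n} u. \<Union>b \<in> Pi {..n} v.
                 prev_fil R F n +>\<^bsub>R\<^esub> (\<Oplus>\<^bsub>R\<^esub>i\<in>{..n}. a i \<otimes>\<^bsub>R\<^esub> b (n - i))),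
       one = (\<lambda>n. if n = 0 then prev_fil R F 0 +>\<^bsub>R\<^esub> \<one>\<^bsub>R\<^esub> else prev_fil R F n),
       zero = prev_fil R F,
       add = (\<lambda>u v n. u n <+>\<^bsub>R\<^esub> v n) \<rparr>"

lemma assoc_graded_mult_coset:
  fixes R (structure)
  assumes R: "ring R" and k: "k \<subseteq> carrier R" and F: "fd_filtration R k F"
    and ab: "\<And>n. a n \<in> F n" "\<And>n. b n \<in> F n"
  shows "((\<lambda>n. prev_fil R F n +>\<^bsub>R\<^esub> a n) \<otimes>\<^bsub>assoc_graded R F\<^esub> (\<lambda>n. prev_fil R F n +>\<^bsub>R\<^esub> b n)) n
    = prev_fil R F n +>\<^bsub>R\<^esub> (\<Oplus>\<^bsub>R\<^esub>i\<in>{..n}. a i \<otimes>\<^bsub>R\<^esub> b (n - i))"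
proof -
  interpret ring R by fact
  have sub: "subgroup (F n) (add_monoid R)" for n
    using F by (auto simp: fd_filtration_def subalgebra_def)
  have z: "subgroup {\<zero>} (add_monoid R)" using add.triv_subgroup by auto
  have subp: "subgroup (prev_fil R F n) (add_monoid R)" for n
    using sub z by (cases n) (auto simp: prev_fil_def)
  have car: "x \<in> F n \<Longrightarrow> x \<in> carrier R" "x \<in> prev_fil R F n \<Longrightarrow> x \<in> carrier R" for x n
    using subgroup.subset[OF sub] subgroup.subset[OF subp] by auto
  have pF: "x \<in> prev_fil R F n \<Longrightarrow> x \<in> F n" for x n
    using F subgroup.one_closed[OF sub[of 0]] by (cases n) (auto simp: fd_filtration_def prev_fil_def)
  have FF: "x \<in> F i \<Longrightarrow> y \<in> F j \<Longrightarrow> x \<otimes> y \<in> F (i + j)" for x y i j using F by (auto simp: fd_filtration_def)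
  have pm: "x \<in> prev_fil R F i \<Longrightarrow> y \<in> F j \<Longrightarrow> x \<otimes> y \<in> prev_fil R F (i + j)" for x y i j
    using subgroup.one_closed[OF subp[of j]] FF[of x "i - 1" y j] car by (cases i) (auto simp: prev_fil_def)
  have mp: "x \<in> F i \<Longrightarrow> y \<in> prev_fil R F j \<Longrightarrow> x \<otimes> y \<in> prev_fil R F (i + j)" for x y i j
    using subgroup.one_closed[OF subp[of i]] FF[of x i y "j - 1"] car by (cases j) (auto simp: prev_fil_def)
  let ?u = "\<lambda>n. prev_fil R F n +> a n" and ?v = "\<lambda>n. prev_fil R F n +> b n"
  have mem: "x \<in> prev_fil R F n +> c \<longleftrightarrow> (\<exists>h\<in>prev_fil R F n. x = h \<oplus> c)" for x c n
    by (auto simp: a_r_coset_def r_coset_def)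
  have uv: "prev_fil R F n +> (\<Oplus>i\<in>{..n}. a' i \<otimes> b' (n - i)) = prev_fil R F n +> (\<Oplus>i\<in>{..n}. a i \<otimes> b (n - i))"
    if a': "a' \<in> Pi {..n} ?u" and b': "b' \<in> Pi {..n} ?v" for a' b'
  proof -
    have "\<exists>h. \<forall>i. i \<le> n \<longrightarrow> h i \<in> prev_fil R F i \<and> a' i = h i \<oplus> a i"
      using a' by (intro choice allI) (simp add: Pi_def mem, blast)
    then obtain h where h: "\<And>i. i \<le> n \<Longrightarrow> h i \<in> prev_fil R F i \<and> a' i = h i \<oplus> a i" by auto
    have "\<exists>h. \<forall>i. i \<le> n \<longrightarrow> h i \<in> prev_fil R F i \<and> b' i = h i \<oplus> b i"
      using b' by (intro choice allI) (simp add: Pi_def mem, blast)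
    then obtain g where g: "\<And>i. i \<le> n \<Longrightarrow> g i \<in> prev_fil R F i \<and> b' i = g i \<oplus> b i" by auto
    define e where "e = (\<lambda>i. h i \<otimes> b' (n - i) \<oplus> a i \<otimes> g (n - i))"
    have e: "e i \<in> prev_fil R F n" "a' i \<otimes> b' (n - i) = e i \<oplus> a i \<otimes> b (n - i)" if "i \<le> n" for i
    proof -
      have *: "b' (n - i) \<in> F (n - i)" "h i \<in> prev_fil R F i" "g (n - i) \<in> prev_fil R F (n - i)"
        using h[OF that] g[of "n - i"] that subgroup.m_closed[OF sub pF ab(2)] by auto
      show "e i \<in> prev_fil R F n"
        unfolding e_def using pm[OF *(2,1)] mp[OF ab(1) *(3), of i] that subgroup.m_closed[OF subp[of n]] by simp
      have c: "h i \<in> carrier R" "g (n - i) \<in> carrier R" "a i \<in> carrier R" "b (n - i) \<in> carrier R"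
        using car(2)[OF *(2)] car(2)[OF *(3)] car(1)[OF ab(1)] car(1)[OF ab(2)] by blast+
      have "a' i = h i \<oplus> a i" "b' (n - i) = g (n - i) \<oplus> b (n - i)"
        using h[OF that] g[of "n - i"] by auto
      then show "a' i \<otimes> b' (n - i) = e i \<oplus> a i \<otimes> b (n - i)"
        using c by (simp add: e_def l_distr r_distr a_assoc a_lcomm)
    qed
    have ec: "i \<le> n \<Longrightarrow> e i \<in> carrier R" for i by (rule car(2)[OF e(1)])
    have "(\<Oplus>i\<in>{..n}. a' i \<otimes> b' (n - i)) = (\<Oplus>i\<in>{..n}. e i \<oplus> a i \<otimes> b (n - i))"
      using ec car(1)[OF ab(1)] car(1)[OF ab(2)] by (intro finsum_cong') (auto simp: e)
    also have "\<dots> = (\<Oplus>i\<in>{..n}. e i) \<oplus> (\<Oplus>i\<in>{..n}. a i \<otimes> b (n - i))"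
      using ec car(1)[OF ab(1)] car(1)[OF ab(2)] by (intro finsum_addf) auto
    finally have 1: "(\<Oplus>i\<in>{..n}. a' i \<otimes> b' (n - i)) = \<dots>" .
    have "(\<Oplus>i\<in>A. e i) \<in> prev_fil R F n" if "finite A" "A \<subseteq> {..n}" for A
      using that
    proof (induction)
      case empty then show ?case using subgroup.one_closed[OF subp] by simp
    next
      case (insert x A)
      then have "(\<Oplus>i\<in>insert x A. e i) = e x \<oplus> (\<Oplus>i\<in>A. e i)" using ec by (intro finsum_insert) auto
      then show ?case using insert e subgroup.m_closed[OF subp[of n]] by auto
    qed
    then have 2: "(\<Oplus>i\<in>{..n}. e i) \<in> prev_fil R F n" by simp
    have s: "(\<Oplus>i\<in>{..n}. a i \<otimes> b (n - i)) \<in> carrier R" using car(1)[OF ab(1)] car(1)[OF ab(2)] by auto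
    have sub_car: "prev_fil R F n \<subseteq> carrier R" by (rule subsetI) (rule car(2))
    have "prev_fil R F n +> ((\<Oplus>i\<in>{..n}. e i) \<oplus> (\<Oplus>i\<in>{..n}. a i \<otimes> b (n - i)))
        = (prev_fil R F n +> (\<Oplus>i\<in>{..n}. e i)) +> (\<Oplus>i\<in>{..n}. a i \<otimes> b (n - i))"
      by (rule a_coset_add_assoc[symmetric, OF sub_car car(2)[OF 2] s])
    also have "prev_fil R F n +> (\<Oplus>i\<in>{..n}. e i) = prev_fil R F n"
      by (rule a_coset_join2[OF car(2)[OF 2] subp 2])
    finally show ?thesis unfolding 1 .
  qed
  have self: "c \<in> prev_fil R F n +> c" if "c \<in> carrier R" for c n
    using that subgroup.one_closed[OF subp[of n]] unfolding mem by (intro bexI[of _ \<zero>]) simp_all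
  have "a \<in> Pi {..n} ?u" "b \<in> Pi {..n} ?v"
    by (intro Pi_I self car(1)[OF ab(1)] car(1)[OF ab(2)])+
  then have "(\<Union>a'\<in>Pi {..n} ?u. \<Union>b'\<in>Pi {..n} ?v. prev_fil R F n +> (\<Oplus>i\<in>{..n}. a' i \<otimes> b' (n - i)))
      = prev_fil R F n +> (\<Oplus>i\<in>{..n}. a i \<otimes> b (n - i))"
    using uv by blast
  then show ?thesis by (simp only: assoc_graded_def monoid.simps)
qed


section \<open>Differential polynomial rings\<close>

definition derivation :: "('a::ring \<Rightarrow> 'a) \<Rightarrow> bool" where
  "derivation d \<longleftrightarrow> (\<forall>a b. d (a + b) = d a + d b) \<and> (\<forall>a b. d (a * b) = d a * b + a * d b)"

lemma derivation_add: "derivation d \<Longrightarrow> d (a + b) = d a + d b"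
  by (simp add: derivation_def)
lemma derivation_mult: "derivation d \<Longrightarrow> d (a * b) = d a * b + a * d b"
  by (simp add: derivation_def)
lemma derivation_0: "derivation (d :: 'a::ring \<Rightarrow> 'a) \<Longrightarrow> d 0 = 0"
  using derivation_add[of d 0 0] by simp
lemma derivation_1: "derivation (d :: 'a::ring_1 \<Rightarrow> 'a) \<Longrightarrow> d 1 = 0"
  using derivation_mult[of d 1 1] by simp
lemma derivation_of_nat: "derivation (d :: 'a::ring_1 \<Rightarrow> 'a) \<Longrightarrow> d (of_nat n) = 0"
  by (induction n) (simp_all add: derivation_0 derivation_1 derivation_add)

text \<open>
  The polynomial \<open>\<Sum>i. a\<^sub>i x^i\<close> is represented by the ordinary polynomial with the same
  (left) coefficients.  Left multiplication by \<open>x\<close> is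
  \<open>x (\<Sum>j. b\<^sub>j x^j) = \<Sum>j. (b\<^sub>j x^(j+1) + d b\<^sub>j x^j)\<close>, by the rule \<open>x b = b x + d b\<close>.
\<close>

definition x_times :: "('a::field \<Rightarrow> 'a) \<Rightarrow> 'a poly \<Rightarrow> 'a poly" where
  "x_times d q = pCons 0 q + map_poly d q"

definition diff_poly_mult :: "('a::field \<Rightarrow> 'a) \<Rightarrow> 'a poly \<Rightarrow> 'a poly \<Rightarrow> 'a poly" where
  "diff_poly_mult d p q = (\<Sum>i\<le>degree p. smult (coeff p i) ((x_times d ^^ i) q))"

definition diff_poly_ring :: "('a::field \<Rightarrow> 'a) \<Rightarrow> 'a poly ring" where
  "diff_poly_ring d =
     \<lparr> carrier = UNIV, monoid.mult = diff_poly_mult d, one = 1, zero = 0, add = (+) \<rparr>"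

lemma map_poly_derivation_add: "derivation d \<Longrightarrow> map_poly d (p + q) = map_poly d p + map_poly d (q::'a::field poly)"
  by (intro poly_eqI) (simp add: coeff_map_poly derivation_0 derivation_add)

lemma x_times_add: "derivation d \<Longrightarrow> x_times d (p + q) = x_times d p + x_times d q"
  by (simp add: x_times_def map_poly_derivation_add)

lemma x_times_smult: "derivation d \<Longrightarrow> x_times d (smult a q) = smult a (x_times d q) + smult (d a) q"
  unfolding x_times_def
  by (intro poly_eqI) (auto simp add: coeff_map_poly derivation_0 derivation_mult coeff_pCons algebra_simps split: nat.splits)

lemma x_times_0: "derivation d \<Longrightarrow> x_times d 0 = 0"
  by (simp add: x_times_def)

lemma x_times_pow_add: "derivation d \<Longrightarrow> (x_times d ^^ n) (p + q) = (x_times d ^^ n) p + (x_times d ^^ n) q"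
  by (induction n) (auto simp: x_times_add)

context
  fixes d :: "'a::field \<Rightarrow> 'a" assumes d: "derivation d"
begin

lemma diff_poly_mult_superset: "degree p \<le> n \<Longrightarrow> diff_poly_mult d p q = (\<Sum>i\<le>n. smult (coeff p i) ((x_times d ^^ i) q))"
  unfolding diff_poly_mult_def by (rule sum.mono_neutral_left) (auto simp: coeff_eq_0)

lemma diff_poly_mult_add_left: "diff_poly_mult d (p + p') q = diff_poly_mult d p q + diff_poly_mult d p' q"
proof -
  define n where "n = max (degree p) (degree p')"
  have "degree p \<le> n" "degree p' \<le> n" "degree (p + p') \<le> n" by (auto simp: n_def degree_add_le_max)
  then show ?thesis by (simp add: diff_poly_mult_superset smult_add_left sum.distrib)
qed

lemma diff_poly_mult_add_right: "diff_poly_mult d p (q + q') = diff_poly_mult d p q + diff_poly_mult d p q'"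
  by (simp add: diff_poly_mult_def x_times_pow_add[OF d] smult_add_right sum.distrib)

lemma smult_sum_distrib: "smult c (\<Sum>i\<in>A. f i) = (\<Sum>i\<in>A. smult c (f i))"
  by (induction A rule: infinite_finite_induct) (auto simp: smult_add_right)

lemma diff_poly_mult_smult: "diff_poly_mult d (smult c p) q = smult c (diff_poly_mult d p q)"
  using diff_poly_mult_superset[of "smult c p" "degree p" q] by (simp add: diff_poly_mult_def smult_sum_distrib)

lemma x_times_sum: "x_times d (\<Sum>i\<in>A. f i) = (\<Sum>i\<in>A. x_times d (f i))"
  by (induction A rule: infinite_finite_induct) (auto simp: x_times_add[OF d] x_times_0[OF d])

lemma diff_poly_mult_pCons0: "diff_poly_mult d (pCons 0 p) q = (\<Sum>i\<le>degree p. smult (coeff p i) ((x_times d ^^ Suc i) q))"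
proof -
  have "diff_poly_mult d (pCons 0 p) q = (\<Sum>i\<le>Suc (degree p). smult (coeff (pCons 0 p) i) ((x_times d ^^ i) q))"
    by (rule diff_poly_mult_superset) (simp add: degree_pCons_le)
  then show ?thesis by (subst (asm) sum.atMost_Suc_shift) simp
qed

lemma diff_poly_mult_x_times: "diff_poly_mult d (x_times d p) q = x_times d (diff_poly_mult d p q)"
proof -
  have "diff_poly_mult d (map_poly d p) q = (\<Sum>i\<le>degree p. smult (d (coeff p i)) ((x_times d ^^ i) q))"
    using diff_poly_mult_superset[of "map_poly d p" "degree p" q] by (simp add: degree_map_poly_le coeff_map_poly derivation_0[OF d])
  then show ?thesis
    unfolding x_times_def[of d p] diff_poly_mult_add_left diff_poly_mult_pCons0
    by (simp add: diff_poly_mult_def x_times_sum x_times_smult[OF d] sum.distrib)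
qed

lemma diff_poly_mult_x_times_pow: "diff_poly_mult d ((x_times d ^^ n) p) q = (x_times d ^^ n) (diff_poly_mult d p q)"
  by (induction n) (auto simp: diff_poly_mult_x_times)

lemma diff_poly_mult_0: "diff_poly_mult d 0 q = 0" by (simp add: diff_poly_mult_def)

lemma diff_poly_mult_sum_left: "diff_poly_mult d (\<Sum>i\<in>A. f i) q = (\<Sum>i\<in>A. diff_poly_mult d (f i) q)"
  by (induction A rule: infinite_finite_induct) (auto simp: diff_poly_mult_add_left diff_poly_mult_0)

lemma diff_poly_mult_assoc: "diff_poly_mult d (diff_poly_mult d p q) r = diff_poly_mult d p (diff_poly_mult d q r)"
proof -
  have "diff_poly_mult d (diff_poly_mult d p q) r = diff_poly_mult d (\<Sum>i\<le>degree p. smult (coeff p i) ((x_times d ^^ i) q)) r" by (simp only: diff_poly_mult_def[of d p q])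
  also have "\<dots> = diff_poly_mult d p (diff_poly_mult d q r)" by (simp only: diff_poly_mult_sum_left diff_poly_mult_smult diff_poly_mult_x_times_pow diff_poly_mult_def[of d p "diff_poly_mult d q r"])
  finally show ?thesis .
qed

lemma x_pow_1: "(x_times d ^^ n) 1 = monom 1 n"
proof (induction n)
  case (Suc n) then show ?case
    by (simp add: x_times_def monom_Suc map_poly_monom derivation_0[OF d] derivation_1[OF d])
qed auto

lemma diff_poly_mult_1_right: "diff_poly_mult d p 1 = p"
  unfolding diff_poly_mult_def x_pow_1 by (simp add: smult_monom poly_as_sum_of_monoms)

lemma diff_poly_mult_1_left: "diff_poly_mult d 1 p = p" by (simp add: diff_poly_mult_def)

lemma ring_diff_poly_ring: "ring (diff_poly_ring d)"
proof (intro ringI abelian_groupI monoidI)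
  fix x show "\<exists>y\<in>carrier (diff_poly_ring d). y \<oplus>\<^bsub>diff_poly_ring d\<^esub> x = \<zero>\<^bsub>diff_poly_ring d\<^esub>"
    by (intro bexI[of _ "-x"]) (auto simp: diff_poly_ring_def)
qed (auto simp: diff_poly_ring_def diff_poly_mult_add_left diff_poly_mult_add_right
      diff_poly_mult_assoc diff_poly_mult_1_left diff_poly_mult_1_right)

lemma diff_poly_ring_x_const: "[:0,1:] \<otimes>\<^bsub>diff_poly_ring d\<^esub> [:a:] = [:a:] \<otimes>\<^bsub>diff_poly_ring d\<^esub> [:0,1:] \<oplus>\<^bsub>diff_poly_ring d\<^esub> [:d a:]"
proof -
  have "map_poly d [:a:] = [:d a:]" for a
    by (intro poly_eqI) (auto simp: coeff_map_poly derivation_0[OF d] coeff_pCons split: nat.splits)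
  then show ?thesis by (auto simp: diff_poly_ring_def diff_poly_mult_def x_times_def)
qed

end


section \<open>The Resco-Small algebra\<close>

text \<open>
  The prime \<open>p\<close> is \<open>CARD('p)\<close>, and \<open>'p mod_ring\<close> is the field with \<open>p\<close> elements.
  \<open>nat \<Rightarrow>\<^sub>0 nat\<close> is the type of monomials in the variables indexed by \<open>nat\<close>.
\<close>

type_synonym 'p rs_poly = "(nat \<Rightarrow>\<^sub>0 nat) \<Rightarrow>\<^sub>0 'p mod_ring"
type_synonym 'p rs_field = "'p rs_poly fract"

definition rs_var :: "nat \<Rightarrow> 'p::prime_card rs_field" where
  "rs_var i = Fraction_Field.Fract (Poly_Mapping.single (Poly_Mapping.single i 1) 1) 1"

text \<open>
  The derivation below exists and is unique.  On polynomials it is the sum of \<open>t\<^sub>i\<^sub>+\<^sub>1 \<partial>/\<partial>t\<^sub>i\<close> over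
  all \<open>i\<close>; the quotient rule extends it to the field of fractions.
\<close>

definition rs_monom_deriv :: "(nat \<Rightarrow>\<^sub>0 nat) \<Rightarrow> 'p::prime_card rs_poly" where
  "rs_monom_deriv m = (\<Sum>i \<in> Poly_Mapping.keys m. of_nat (Poly_Mapping.lookup m i) *
      Poly_Mapping.single (m - Poly_Mapping.single i 1 + Poly_Mapping.single (Suc i) 1) 1)"

lemma rs_monom_deriv_superset:
  assumes "finite A" "Poly_Mapping.keys m \<subseteq> A"
  shows "rs_monom_deriv m = (\<Sum>i \<in> A. of_nat (Poly_Mapping.lookup m i) *
      Poly_Mapping.single (m - Poly_Mapping.single i 1 + Poly_Mapping.single (Suc i) 1) 1)"
  unfolding rs_monom_deriv_def using assms
  by (intro sum.mono_neutral_left) (auto simp: in_keys_iff)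

lemma rs_shift:
  assumes "Poly_Mapping.lookup m i \<noteq> 0"
  shows "(m - Poly_Mapping.single i 1 + Poly_Mapping.single (Suc i) (1::nat)) + n
        = (m + n) - Poly_Mapping.single i 1 + Poly_Mapping.single (Suc i) 1"
  using assms by (intro poly_mapping_eqI) (auto simp: lookup_add lookup_minus lookup_single when_def)

lemma rs_monom_deriv_add: "(rs_monom_deriv (m + n) :: 'p::prime_card rs_poly) =
   rs_monom_deriv m * Poly_Mapping.single n 1 + Poly_Mapping.single m 1 * rs_monom_deriv n"
proof -
  define A where "A = Poly_Mapping.keys m \<union> Poly_Mapping.keys n"
  have A: "finite A" "Poly_Mapping.keys m \<subseteq> A" "Poly_Mapping.keys n \<subseteq> A" "Poly_Mapping.keys (m + n) \<subseteq> A"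
    using keys_add[of m n] by (auto simp: A_def)
  let ?s = "\<lambda>m i. Poly_Mapping.single (m - Poly_Mapping.single i 1 + Poly_Mapping.single (Suc i) 1) 1 :: 'p rs_poly"
  have 1: "of_nat (Poly_Mapping.lookup m i) * ?s (m + n) i = of_nat (Poly_Mapping.lookup m i) * ?s m i * Poly_Mapping.single n 1" for i m n
    by (cases "Poly_Mapping.lookup m i = 0") (use rs_shift[of m i n] in \<open>auto simp: mult_single mult.assoc\<close>)
  have "rs_monom_deriv (m + n) = (\<Sum>i\<in>A. of_nat (Poly_Mapping.lookup m i) * ?s (m + n) i + of_nat (Poly_Mapping.lookup n i) * ?s (m + n) i)"
    unfolding rs_monom_deriv_superset[OF A(1,4)] by (intro sum.cong) (auto simp: lookup_add distrib_right)
  also have "\<dots> = (\<Sum>i\<in>A. of_nat (Poly_Mapping.lookup m i) * ?s m i * Poly_Mapping.single n 1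
         + of_nat (Poly_Mapping.lookup n i) * ?s n i * Poly_Mapping.single m 1)"
    by (intro sum.cong refl arg_cong2[where f = "(+)"]) (use 1 1[of n _ m] in \<open>simp_all add: add.commute\<close>)
  also have "\<dots> = rs_monom_deriv m * Poly_Mapping.single n 1 + Poly_Mapping.single m 1 * rs_monom_deriv n"
    by (simp add: rs_monom_deriv_superset[OF A(1,2)] rs_monom_deriv_superset[OF A(1,3)] sum.distrib sum_distrib_right sum_distrib_left mult.commute)
  finally show ?thesis .
qed

definition rs_poly_deriv :: "'p::prime_card rs_poly \<Rightarrow> 'p rs_poly" where
  "rs_poly_deriv f = (\<Sum>m \<in> Poly_Mapping.keys f. Poly_Mapping.single 0 (Poly_Mapping.lookup f m) * rs_monom_deriv m)"

lemma rs_poly_deriv_superset: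
  assumes "finite A" "Poly_Mapping.keys f \<subseteq> A"
  shows "rs_poly_deriv f = (\<Sum>m \<in> A. Poly_Mapping.single 0 (Poly_Mapping.lookup f m) * rs_monom_deriv m)"
  unfolding rs_poly_deriv_def using assms
  by (intro sum.mono_neutral_left) (auto simp: in_keys_iff)

lemma rs_poly_deriv_add: "rs_poly_deriv (f + g) = rs_poly_deriv f + rs_poly_deriv g"
proof -
  define A where "A = Poly_Mapping.keys f \<union> Poly_Mapping.keys g"
  have A: "finite A" "Poly_Mapping.keys f \<subseteq> A" "Poly_Mapping.keys g \<subseteq> A" "Poly_Mapping.keys (f + g) \<subseteq> A"
    using keys_add[of f g] by (auto simp: A_def)
  show ?thesis unfolding rs_poly_deriv_superset[OF A(1,2)] rs_poly_deriv_superset[OF A(1,3)] rs_poly_deriv_superset[OF A(1,4)]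
    by (simp add: lookup_add single_add distrib_right sum.distrib)
qed

lemma rs_poly_deriv_0: "rs_poly_deriv 0 = 0" by (simp add: rs_poly_deriv_def)

lemma rs_poly_deriv_sum: "rs_poly_deriv (\<Sum>i\<in>A. f i) = (\<Sum>i\<in>A. rs_poly_deriv (f i))"
  by (induction A rule: infinite_finite_induct) (auto simp: rs_poly_deriv_0 rs_poly_deriv_add)

lemma rs_poly_deriv_single: "rs_poly_deriv (Poly_Mapping.single m c) = Poly_Mapping.single 0 c * rs_monom_deriv m"
  by (simp add: rs_poly_deriv_def)

lemma rs_poly_expand: "(\<Sum>m\<in>Poly_Mapping.keys f. Poly_Mapping.single m (Poly_Mapping.lookup f m)) = (f :: 'a \<Rightarrow>\<^sub>0 'b::comm_monoid_add)"
  by (intro poly_mapping_eqI) (auto simp: lookup_sum lookup_single when_def in_keys_iff)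

lemma rs_poly_deriv_mult_single:
  fixes c e :: "'p::prime_card mod_ring"
  shows "rs_poly_deriv (Poly_Mapping.single m c * Poly_Mapping.single n e) =
   rs_poly_deriv (Poly_Mapping.single m c) * Poly_Mapping.single n e + Poly_Mapping.single m c * rs_poly_deriv (Poly_Mapping.single n e)"
proof -
  have 1: "Poly_Mapping.single m c = Poly_Mapping.single 0 c * Poly_Mapping.single m 1"
    for m :: "nat \<Rightarrow>\<^sub>0 nat" and c :: "'p mod_ring"
    by (simp add: mult_single)
  have 2: "Poly_Mapping.single 0 (c * e) = Poly_Mapping.single 0 c * (Poly_Mapping.single 0 e :: 'p rs_poly)"
    by (simp add: mult_single)
  have 3: "rs_poly_deriv (Poly_Mapping.single m c * Poly_Mapping.single n e) = Poly_Mapping.single 0 (c * e) * rs_monom_deriv (m + n)"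
    by (simp add: mult_single rs_poly_deriv_single)
  show ?thesis
    unfolding 3 rs_poly_deriv_single rs_monom_deriv_add[of m n] 2 unfolding 1[of m c] 1[of n e] by (simp add: algebra_simps)
qed

lemma rs_poly_deriv_mult: "rs_poly_deriv (f * g) = rs_poly_deriv f * g + f * rs_poly_deriv g"
proof -
  let ?t = "\<lambda>f m. Poly_Mapping.single m (Poly_Mapping.lookup f m)"
  have "rs_poly_deriv ((\<Sum>m\<in>Poly_Mapping.keys f. ?t f m) * (\<Sum>n\<in>Poly_Mapping.keys g. ?t g n)) =
     rs_poly_deriv (\<Sum>m\<in>Poly_Mapping.keys f. ?t f m) * (\<Sum>n\<in>Poly_Mapping.keys g. ?t g n) + (\<Sum>m\<in>Poly_Mapping.keys f. ?t f m) * rs_poly_deriv (\<Sum>n\<in>Poly_Mapping.keys g. ?t g n)"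
    unfolding sum_product rs_poly_deriv_sum rs_poly_deriv_mult_single sum.distrib ..
  then show ?thesis unfolding rs_poly_expand .
qed

definition rs_emb :: "'p::prime_card rs_poly \<Rightarrow> 'p rs_field" where
  "rs_emb a = Fraction_Field.Fract a 1"

lemma rs_emb_add: "rs_emb (a + b) = rs_emb a + rs_emb b" by (simp add: rs_emb_def)
lemma rs_emb_mult: "rs_emb (a * b) = rs_emb a * rs_emb b" by (simp add: rs_emb_def)
lemma rs_emb_0: "rs_emb 0 = 0" by (simp add: rs_emb_def Zero_fract_def)
lemma rs_emb_1: "rs_emb 1 = 1" by (simp add: rs_emb_def One_fract_def)
lemma rs_emb_eq: "rs_emb a = rs_emb b \<longleftrightarrow> a = b" by (simp add: rs_emb_def eq_fract)
lemma rs_emb_eq_0: "rs_emb a = 0 \<longleftrightarrow> a = 0" using rs_emb_eq[of a 0] by (simp add: rs_emb_0)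
lemma Fract_rs_emb: "Fraction_Field.Fract a b = rs_emb a / rs_emb b"
  by (simp add: rs_emb_def)

lemma rs_derivation_ex: "\<exists>d :: 'p::prime_card rs_field \<Rightarrow> _. derivation d \<and> (\<forall>i. d (rs_var i) = rs_var (Suc i))"
proof -
  define Q where "Q = (\<lambda>a b :: 'p rs_poly. (rs_emb (rs_poly_deriv a) * rs_emb b - rs_emb a * rs_emb (rs_poly_deriv b)) / (rs_emb b)^2)"
  have Q: "Q a b = Q a' b'" if "b \<noteq> 0" "b' \<noteq> 0" "rs_emb a / rs_emb b = rs_emb a' / rs_emb b'" for a b a' b'
  proof -
    have nz: "rs_emb b \<noteq> 0" "rs_emb b' \<noteq> 0" using that by (auto simp: rs_emb_eq_0)
    from that(3) nz have eq: "rs_emb a * rs_emb b' = rs_emb a' * rs_emb b" by (simp add: field_simps)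
    then have "a * b' = a' * b" by (simp add: rs_emb_mult[symmetric] rs_emb_eq)
    then have "rs_poly_deriv a * b' + a * rs_poly_deriv b' = rs_poly_deriv a' * b + a' * rs_poly_deriv b" by (metis rs_poly_deriv_mult)
    then have eq2: "rs_emb (rs_poly_deriv a) * rs_emb b' + rs_emb a * rs_emb (rs_poly_deriv b') = rs_emb (rs_poly_deriv a') * rs_emb b + rs_emb a' * rs_emb (rs_poly_deriv b)"
      unfolding rs_emb_mult[symmetric] rs_emb_add[symmetric] by simp
    define x y x' y' u v u' v' where defs: "x = rs_emb a" "y = rs_emb b" "x' = rs_emb a'" "y' = rs_emb b'"
      "u = rs_emb (rs_poly_deriv a)" "v = rs_emb (rs_poly_deriv b)" "u' = rs_emb (rs_poly_deriv a')" "v' = rs_emb (rs_poly_deriv b')"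
    have "(u * y - x * v) * y'^2 = (u' * y' - x' * v') * y^2"
    proof -
      have e1: "x * y' = x' * y" and e2: "u * y' = u' * y + x' * v - x * v'"
        using eq eq2 unfolding defs[symmetric] by (simp_all add: algebra_simps)
      have "(u * y - x * v) * y'^2 = y * y' * (u * y') - v * y' * (x * y')"
        by (simp add: power2_eq_square algebra_simps)
      also have "\<dots> = y * y' * u' * y - v' * y * (x * y')"
        unfolding e2 by (simp add: e1 algebra_simps)
      also have "\<dots> = (u' * y' - x' * v') * y^2"
        unfolding e1 by (simp add: power2_eq_square algebra_simps)
      finally show ?thesis .
    qed
    then show ?thesis using nz unfolding Q_def defs[symmetric] by (simp add: frac_eq_eq)
  qed
  define d where "d = (\<lambda>q :: 'p rs_field. case SOME (a, b). b \<noteq> 0 \<and> q = rs_emb a / rs_emb b of (a, b) \<Rightarrow> Q a b)"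
  have d: "d (rs_emb a / rs_emb b) = Q a b" if "b \<noteq> 0" for a b
  proof -
    obtain a' b' where ab: "(SOME (a', b'). b' \<noteq> 0 \<and> rs_emb a / rs_emb b = rs_emb a' / rs_emb b') = (a', b')"
      by force
    have "case (a', b') of (a', b') \<Rightarrow> b' \<noteq> 0 \<and> rs_emb a / rs_emb b = rs_emb a' / rs_emb b'"
      unfolding ab[symmetric] by (rule someI[of _ "(a, b)"]) (use that in auto)
    then show ?thesis using Q[of b b' a a'] that unfolding d_def ab by simp
  qed
  have cases: "\<exists>a b. b \<noteq> 0 \<and> q = rs_emb a / rs_emb b" for q :: "'p rs_field"
    by (cases q) (metis Fract_rs_emb)
  have add: "d (q + r) = d q + d r" and mult: "d (q * r) = d q * r + q * d r" for q r
  proof -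
    obtain a b a' b' where ab: "b \<noteq> 0" "q = rs_emb a / rs_emb b" "b' \<noteq> 0" "r = rs_emb a' / rs_emb b'"
      using cases by metis
    have nz: "rs_emb b \<noteq> 0" "rs_emb b' \<noteq> 0" "b * b' \<noteq> 0" using ab by (auto simp: rs_emb_eq_0)
    have 1: "q + r = rs_emb (a * b' + a' * b) / rs_emb (b * b')"
      using nz unfolding ab rs_emb_add rs_emb_mult by (simp add: field_simps)
    have 2: "q * r = rs_emb (a * a') / rs_emb (b * b')"
      unfolding ab rs_emb_add rs_emb_mult by (simp)
    show "d (q + r) = d q + d r"
      unfolding 1 d[OF nz(3)] unfolding ab d[OF ab(1)] d[OF ab(3)]
      unfolding Q_def rs_poly_deriv_add rs_poly_deriv_mult rs_emb_mult rs_emb_add using nz(1,2)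
      by (simp add: divide_simps power2_eq_square)
        (simp add: algebra_simps)
    show "d (q * r) = d q * r + q * d r"
      unfolding 2 d[OF nz(3)] unfolding ab d[OF ab(1)] d[OF ab(3)]
      unfolding Q_def rs_poly_deriv_add rs_poly_deriv_mult rs_emb_mult rs_emb_add using nz(1,2)
      by (simp add: divide_simps power2_eq_square)
        (simp add: algebra_simps)
  qed
  have "rs_poly_deriv 1 = (0 :: 'p rs_poly)" by (metis rs_poly_deriv_mult add_cancel_right_right mult_1 mult.right_neutral)
  moreover have "rs_poly_deriv (Poly_Mapping.single (Poly_Mapping.single i 1) 1) = (Poly_Mapping.single (Poly_Mapping.single (Suc i) 1) 1 :: 'p rs_poly)" for i
    by (simp add: rs_poly_deriv_single rs_monom_deriv_def)
  ultimately have "d (rs_var i) = rs_var (Suc i)" for i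
    using d[of 1 "Poly_Mapping.single (Poly_Mapping.single i 1) 1"]
    by (simp add: Q_def rs_var_def rs_emb_def[symmetric] rs_emb_0 rs_emb_1)
  with add mult show ?thesis unfolding derivation_def by blast
qed

lemma rs_derivation_unique:
  fixes d d' :: "'p::prime_card rs_field \<Rightarrow> 'p rs_field"
  assumes d: "derivation d" and d': "derivation d'" and eq: "\<And>i. d (rs_var i) = d' (rs_var i)"
  shows "d = d'"
proof -
  define S where "S = {q. d q = d' q}"
  have S_add: "q + r \<in> S" and S_mult: "q * r \<in> S" if "q \<in> S" "r \<in> S" for q r
    using that by (simp_all add: S_def derivation_add[OF d] derivation_add[OF d'] derivation_mult[OF d] derivation_mult[OF d'])
  have S_nat: "of_nat n \<in> S" for n
    by (simp add: S_def derivation_of_nat[OF d] derivation_of_nat[OF d'])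
  have S_div: "q / r \<in> S" if "q \<in> S" "r \<in> S" "r \<noteq> 0" for q r
  proof -
    have "d q = d (q / r) * r + q / r * d r" "d' q = d' (q / r) * r + q / r * d' r"
      using derivation_mult[OF d, of "q/r" r] derivation_mult[OF d', of "q/r" r] that(3) by simp_all
    with that show ?thesis by (auto simp: S_def)
  qed
  have const: "rs_emb (Poly_Mapping.single 0 c) \<in> S" for c :: "'p mod_ring"
  proof -
    obtain n where n: "c = of_nat n"
    proof
      show "c = of_nat (nat (to_int_mod_ring c))"
        using range_to_int_mod_ring[where 'a='p] by (simp add: of_nat_of_int_mod_ring) (metis atLeastLessThan_iff of_int_mod_ring_to_int_mod_ring nat_0_le rangeI)
    qed
    have "rs_emb (of_nat n :: 'p rs_poly) = of_nat n" by (induction n) (simp_all add: rs_emb_0 rs_emb_1 rs_emb_add)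
    with S_nat[of n] show ?thesis by (simp add: n)
  qed
  have mono: "rs_emb (Poly_Mapping.single m 1) \<in> S" for m
  proof -
    have pow: "rs_emb (Poly_Mapping.single (Poly_Mapping.single i n) 1) \<in> S" for i n
    proof (induction n)
      case 0 then show ?case using S_nat[of 1] by (simp add: rs_emb_1)
    next
      case (Suc n)
      have "rs_emb (Poly_Mapping.single (Poly_Mapping.single i 1) 1) \<in> S"
        using eq[of i] by (simp add: S_def rs_var_def rs_emb_def)
      from S_mult[OF this Suc] show ?case by (simp add: rs_emb_mult[symmetric] mult_single single_add[symmetric])
    qed
    have "rs_emb (Poly_Mapping.single (\<Sum>i\<in>A. Poly_Mapping.single i (Poly_Mapping.lookup m i)) 1) \<in> S" if "finite A" for A
      using that
    proof induction
      case empty then show ?case using S_nat[of 1] by (simp add: rs_emb_1)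
    next
      case (insert i A)
      from S_mult[OF pow[of i "Poly_Mapping.lookup m i"] insert(3)] insert(1,2) show ?case by (simp add: rs_emb_mult[symmetric] mult_single)
    qed
    from this[of "Poly_Mapping.keys m"] show ?thesis by (simp add: rs_poly_expand)
  qed
  have rs_emb: "rs_emb f \<in> S" for f
  proof -
    have "rs_emb (\<Sum>m\<in>A. Poly_Mapping.single m (Poly_Mapping.lookup f m)) \<in> S" if "finite A" for A
      using that
    proof induction
      case empty then show ?case using S_nat[of 0] by (simp add: rs_emb_0)
    next
      case (insert m A)
      have "rs_emb (Poly_Mapping.single m (Poly_Mapping.lookup f m)) \<in> S"
        using S_mult[OF const[of "Poly_Mapping.lookup f m"] mono[of m]] by (simp add: rs_emb_mult[symmetric] mult_single)
      from S_add[OF this insert(3)] insert(1,2) show ?case by (simp add: rs_emb_add)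
    qed
    from this[of "Poly_Mapping.keys f"] show ?thesis by (simp add: rs_poly_expand)
  qed
  have "q \<in> S" for q
  proof (cases q)
    case (Fract a b)
    then show ?thesis using S_div[OF rs_emb rs_emb, of b a] by (auto simp: rs_emb_eq_0 Fract_rs_emb)
  qed
  then show ?thesis by (auto simp: S_def)
qed

definition rs_deriv :: "'p::prime_card rs_field \<Rightarrow> 'p rs_field" where
  "rs_deriv = (THE d. derivation d \<and> (\<forall>i. d (rs_var i) = rs_var (Suc i)))"

lemma rs_deriv:
  shows "derivation (rs_deriv :: 'a::prime_card rs_field \<Rightarrow> _)"
    and "rs_deriv (rs_var i :: 'a rs_field) = rs_var (Suc i)"
proof -
  have "\<exists>!d :: 'a rs_field \<Rightarrow> _. derivation d \<and> (\<forall>i. d (rs_var i) = rs_var (Suc i))"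
    using rs_derivation_ex rs_derivation_unique by (metis (no_types, lifting))
  from theI'[OF this] show "derivation (rs_deriv :: 'a rs_field \<Rightarrow> _)" and "rs_deriv (rs_var i) = (rs_var (Suc i) :: 'a rs_field)"
    unfolding rs_deriv_def by blast+
qed

definition resco_small :: "'p::prime_card rs_field poly ring" where
  "resco_small = diff_poly_ring rs_deriv"

lemma ring_resco_small: "ring resco_small" unfolding resco_small_def by (rule ring_diff_poly_ring[OF rs_deriv(1)])

definition rs_base :: "'p::prime_card rs_field poly set" where
  "rs_base = (\<lambda>a. [:a ^ CARD('p):]) ` UNIV"

end

theory Submission
  imports Defs
begin

text \<open>
  Write \<open>k = K^p\<close> and let \<open>F\<close> be a filtration of \<open>R = K[x;\<delta>]\<close> whose associated graded ring is right
  Noetherian.  The proof shows that \<open>K\<close> would then be finite-dimensional over \<open>k\<close>, whereas the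
  variables \<open>t\<^sub>i\<close> are linearly independent over \<open>k\<close> (\<open>p_independent\<close>).

  For a field \<open>V\<close> with \<open>k \<subseteq> V \<subseteq> K\<close> let \<open>V F\<^sub>n\<close> be the left \<open>V\<close>-subspace of \<open>R\<close> spanned by \<open>F\<^sub>n\<close>.
  The main point is the existence of a field \<open>V\<close>, finite over \<open>k\<close>, such that
  \<open>V F\<^sub>n \<inter> K F\<^bsub>n-1\<^esub> \<subseteq> V F\<^bsub>n-1\<^esub>\<close> for all \<open>n\<close> (\<open>KF_below_descent\<close>).  Every \<open>b \<in> K\<close> lies in some \<open>F\<^sub>n\<close>
  and also in \<open>K F\<^sub>0\<close>, so that descending from \<open>n\<close> to \<open>0\<close> puts \<open>b\<close> into \<open>V F\<^sub>0\<close>, which has finite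
  dimension over \<open>k\<close>.

  The field \<open>V\<close> is found one leading coefficient at a time.  As \<open>gr F\<close> is generated in bounded
  degrees, there is a maximal slope \<open>q / m\<close> of the \<open>x\<close>-degree against the filtration degree, attained
  by some \<open>w \<in> F\<^sub>m\<close> of \<open>x\<close>-degree \<open>q\<close> (\<open>slope_exists\<close>).  The defect of an element of \<open>x\<close>-degree \<open>i\<close> in
  filtration degree \<open>n\<close> is \<open>q n - m i\<close>; it is nonnegative on \<open>F\<^sub>n\<close>, it adds up under
  multiplication, and it does not change when \<open>f \<in> F\<^sub>n\<close> is replaced by \<open>f w \<in> F\<^bsub>n+m\<^esub>\<close>.  Since each of
  \<open>1, x, \<dots>, x^(q-1)\<close> lies in some \<open>F\<^sub>n\<close>, polynomials of defect larger than a constant \<open>C\<close> in degree \<open>n\<close>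
  lie in \<open>K F\<^bsub>n-1\<^esub>\<close> (\<open>defect_ge_large\<close>).  So only the finitely many defects \<open>0, \<dots>, C\<close> matter
  modulo \<open>K F\<^bsub>n-1\<^esub>\<close>.

  Let \<open>J\<^sub>n\<^sub>,\<^sub>c\<close> be the sum of \<open>K F\<^bsub>n-1\<^esub>\<close> and the space of polynomials of defect at least \<open>c\<close>.  By induction
  on \<open>c\<close> there is a finite extension \<open>V\<close> of \<open>k\<close> such that \<open>V' F\<^sub>n \<inter> J\<^sub>n\<^sub>,\<^sub>c\<close> is spanned over \<open>V'\<close> by
  \<open>V F\<^sub>n \<inter> J\<^sub>n\<^sub>,\<^sub>c\<close>, for all \<open>n\<close> and all finite extensions \<open>V'\<close> of \<open>V\<close> (\<open>KF_defect_ge_descent\<close>).  In the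
  induction step the spaces \<open>V F\<^sub>n \<inter> J\<^sub>n\<^sub>,\<^sub>c\<close> form a right module, finitely generated because \<open>gr (V F)\<close> is
  again Noetherian (\<open>gr_noetherian_coeff_span\<close>).  Hence the coefficients of its elements at defect \<open>c\<close> all
  lie in a finite extension of \<open>k\<close> (\<open>has_defect_coeff_extension\<close>), and over that extension one
  pivot suffices to eliminate them.  For \<open>c = C + 1\<close> the space \<open>J\<^sub>n\<^sub>,\<^sub>c\<close> is \<open>K F\<^bsub>n-1\<^esub>\<close>, and finite
  generation applied once more yields the field of the main point.
\<close>

section \<open>Degrees in a differential polynomial ring\<close>

lemma x_times_pow_coeff:
  assumes d: "derivation d" and "degree q \<le> j"
  shows "degree ((x_times d ^^ i) q) \<le> i + j \<and> coeff ((x_times d ^^ i) q) (i + j) = coeff q j"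
proof (induction i)
  case 0 then show ?case using assms by simp
next
  case (Suc i)
  let ?r = "(x_times d ^^ i) q"
  have dm: "degree (map_poly d ?r) \<le> i + j"
    using Suc degree_map_poly_le[of d ?r] by linarith
  have "degree (pCons 0 ?r) \<le> Suc (i + j)"
    using Suc degree_pCons_le[of 0 ?r] by linarith
  then have "degree (x_times d ?r) \<le> Suc (i + j)"
    unfolding x_times_def[of d ?r] using dm by (intro degree_add_le) auto
  moreover have "coeff (map_poly d ?r) (Suc (i + j)) = 0"
    using dm by (intro coeff_eq_0) auto
  ultimately show ?case using Suc by (simp add: x_times_def[of d ?r])
qed

lemma diff_poly_mult_coeff:
  assumes d: "derivation d" and f: "degree f \<le> i" and g: "degree g \<le> j"
  shows "degree (diff_poly_mult d f g) \<le> i + j"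
    and "coeff (diff_poly_mult d f g) (i + j) = coeff f i * coeff g j"
proof -
  note X = x_times_pow_coeff[OF d g]
  have e: "diff_poly_mult d f g = (\<Sum>l\<le>i. smult (coeff f l) ((x_times d ^^ l) g))"
    by (rule diff_poly_mult_superset[OF d f])
  show "degree (diff_poly_mult d f g) \<le> i + j" unfolding e
  proof (intro degree_sum_le)
    fix l assume "l \<in> {..i}"
    then show "degree (smult (coeff f l) ((x_times d ^^ l) g)) \<le> i + j"
      using X[of l] degree_smult_le[of "coeff f l" "(x_times d ^^ l) g"] by simp
  qed simp
  have "coeff (diff_poly_mult d f g) (i + j) = (\<Sum>l\<le>i. coeff f l * coeff ((x_times d ^^ l) g) (i + j))"
    unfolding e by (simp add: coeff_sum)
  also have "\<dots> = (\<Sum>l\<le>i. if l = i then coeff f i * coeff g j else 0)"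
  proof (rule sum.cong[OF refl])
    fix l assume l: "l \<in> {..i}"
    show "coeff f l * coeff ((x_times d ^^ l) g) (i + j) = (if l = i then coeff f i * coeff g j else 0)"
    proof (cases "l = i")
      case False
      then have "coeff ((x_times d ^^ l) g) (i + j) = 0" using l X[of l] by (intro coeff_eq_0) auto
      with False show ?thesis by simp
    qed (use X[of i] in simp)
  qed
  also have "\<dots> = coeff f i * coeff g j" by simp
  finally show "coeff (diff_poly_mult d f g) (i + j) = coeff f i * coeff g j" .
qed

lemma diff_poly_mult_degree:
  assumes d: "derivation d" and "f \<noteq> 0" "g \<noteq> 0"
  shows "diff_poly_mult d f g \<noteq> 0" "degree (diff_poly_mult d f g) = degree f + degree g"
proof -
  have "coeff (diff_poly_mult d f g) (degree f + degree g) \<noteq> 0"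
    using assms by (simp add: diff_poly_mult_coeff(2)[OF d])
  then show "diff_poly_mult d f g \<noteq> 0" "degree (diff_poly_mult d f g) = degree f + degree g"
    using diff_poly_mult_coeff(1)[OF d order_refl order_refl, of f g] le_degree
    by (auto intro: antisym)
qed

section \<open>Linear algebra over the subfield of p-th powers\<close>

text \<open>
  A derivation of a field \<open>K\<close> on which \<open>a \<mapsto> a^p\<close> is additive.  The image of this map is the subfield
  \<open>k = K^p\<close>.
\<close>

locale frobenius_derivation =
  fixes d :: "'a::field \<Rightarrow> 'a" and p :: nat
  assumes deriv: "derivation d" and p_pos: "p > 0"
    and frob: "\<And>a b :: 'a. (a + b) ^ p = a ^ p + b ^ p"
begin

text \<open>
  \<open>K\<close> acts on \<open>K\<close> and on \<open>K[x]\<close> through \<open>a \<mapsto> a^p\<close>.  Subspaces, spans and bases for these actions are the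
  same as those over \<open>k\<close>, so \<open>k\<close> need not be made into a type.
\<close>

definition field_scale :: "'a \<Rightarrow> 'a \<Rightarrow> 'a" where "field_scale a v = a ^ p * v"

definition poly_scale :: "'a \<Rightarrow> 'a poly \<Rightarrow> 'a poly" where "poly_scale a f = smult (a ^ p) f"

lemma field_scale_mult: "field_scale c x * y = field_scale c (x * y)" "x * field_scale c y = field_scale c (x * y)"
  by (simp_all add: field_scale_def mult_ac)

sublocale kK: vector_space field_scale
  by standard (simp_all add: field_scale_def distrib_left distrib_right frob power_mult_distrib mult_ac)

sublocale kR: vector_space poly_scale
  by standard (simp_all add: poly_scale_def smult_add_right smult_add_left frob power_mult_distrib mult_ac)

abbreviation dmult (infixl "\<star>" 70) where "f \<star> g \<equiv> diff_poly_mult d f g"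

lemmas dmult_add_left = diff_poly_mult_add_left[OF deriv]
lemmas dmult_smult = diff_poly_mult_smult[OF deriv]
lemmas dmult_0 = diff_poly_mult_0[OF deriv]
lemmas dmult_assoc = diff_poly_mult_assoc[OF deriv]
lemmas dmult_one = diff_poly_mult_1_right[OF deriv] diff_poly_mult_1_left[OF deriv]

lemma dmult_0_right: "f \<star> 0 = 0"
proof -
  have "f \<star> 0 + f \<star> 0 = f \<star> 0 + 0" by (simp flip: diff_poly_mult_add_right[OF deriv])
  then show ?thesis by (simp only: add_left_cancel)
qed

lemma dmult_span:
  assumes "u \<in> kR.span U" "\<And>f. f \<in> U \<Longrightarrow> f \<star> r \<in> W" "kR.subspace W"
  shows "u \<star> r \<in> W"
  using assms(1)
proof (induction rule: kR.span_induct_alt)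
  case base then show ?case using kR.subspace_0[OF assms(3)] by (simp add: dmult_0)
next
  case (step c x y)
  then show ?case
    using kR.subspace_add[OF assms(3) kR.subspace_scale[OF assms(3), of "x \<star> r" c]] assms(2)
    by (simp add: dmult_add_left dmult_smult poly_scale_def)
qed

text \<open>
  The \<open>k\<close>-subspace of \<open>K[x]\<close> spanned by the products of elements of \<open>V\<close> and of \<open>U\<close>.  If \<open>V\<close> is a subring
  that contains \<open>k\<close>, this is the left \<open>V\<close>-module generated by \<open>U\<close>; for \<open>V = UNIV\<close> it is \<open>K U\<close>.
\<close>

definition coeff_span :: "'a set \<Rightarrow> 'a poly set \<Rightarrow> 'a poly set" where
  "coeff_span V U = kR.span {smult v u |v u. v \<in> V \<and> u \<in> U}"

lemma coeff_span_subspace: "kR.subspace (coeff_span V U)" by (simp add: coeff_span_def kR.subspace_span)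

lemma coeff_span_base: "v \<in> V \<Longrightarrow> u \<in> U \<Longrightarrow> smult v u \<in> coeff_span V U"
  unfolding coeff_span_def by (intro kR.span_base) auto

lemma coeff_span_minimal:
  assumes "kR.subspace W" "\<And>v u. v \<in> V \<Longrightarrow> u \<in> U \<Longrightarrow> smult v u \<in> W"
  shows "coeff_span V U \<subseteq> W"
  unfolding coeff_span_def using assms by (intro kR.span_minimal) auto

lemma coeff_span_mono: "V \<subseteq> V' \<Longrightarrow> U \<subseteq> U' \<Longrightarrow> coeff_span V U \<subseteq> coeff_span V' U'"
  by (intro coeff_span_minimal coeff_span_subspace coeff_span_base) auto

lemma subspace_smult_vimage: "kR.subspace W \<Longrightarrow> kR.subspace {u. smult a u \<in> W}"
proof -
  assume W: "kR.subspace W"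
  show ?thesis
  proof (rule kR.subspaceI)
    fix c u assume "u \<in> {u. smult a u \<in> W}"
    then show "poly_scale c u \<in> {u. smult a u \<in> W}"
      using kR.subspace_scale[OF W, of "smult a u" c] by (simp add: poly_scale_def mult.commute)
  qed (use kR.subspace_0[OF W] kR.subspace_add[OF W] in \<open>auto simp: smult_add_right\<close>)
qed

lemma coeff_span_smult:
  assumes "\<And>v w. v \<in> V \<Longrightarrow> w \<in> V \<Longrightarrow> v * w \<in> V" "a \<in> V" "w \<in> coeff_span V U"
  shows "smult a w \<in> coeff_span V U"
proof -
  have "coeff_span V U \<subseteq> {u. smult a u \<in> coeff_span V U}"
    by (intro coeff_span_minimal subspace_smult_vimage coeff_span_subspace) (use assms(1,2) in \<open>auto intro: coeff_span_base\<close>)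
  then show ?thesis using assms(3) by auto
qed

lemma coeff_span_dmult:
  assumes "w \<in> coeff_span V U" "\<And>u. u \<in> U \<Longrightarrow> u \<star> r \<in> U'"
  shows "w \<star> r \<in> coeff_span V U'"
  using assms(1) unfolding coeff_span_def[of V U]
proof (rule dmult_span)
  fix f assume "f \<in> {smult v u |v u. v \<in> V \<and> u \<in> U}"
  then obtain v u where f: "f = smult v u" "v \<in> V" "u \<in> U" by auto
  show "f \<star> r \<in> coeff_span V U'" unfolding f(1) dmult_smult by (rule coeff_span_base) (use f assms(2) in auto)
qed (rule coeff_span_subspace)

lemma coeff_span_finite:
  assumes "w \<in> coeff_span UNIV U" shows "\<exists>Z. finite Z \<and> w \<in> coeff_span Z U"
  using assms unfolding coeff_span_def
proof (induction rule: kR.span_induct_alt)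
  case base then show ?case using kR.span_zero by auto
next
  case (step c x y)
  then obtain Z v u where Z: "finite Z" "y \<in> coeff_span Z U" "x = smult v u" "u \<in> U" by (auto simp: coeff_span_def)
  have "poly_scale c x \<in> coeff_span (insert v Z) U"
    unfolding Z(3) by (intro kR.subspace_scale[OF coeff_span_subspace] coeff_span_base Z) simp
  moreover have "y \<in> coeff_span (insert v Z) U" using Z coeff_span_mono[of Z "insert v Z" U U] by auto
  ultimately have "poly_scale c x + y \<in> coeff_span (insert v Z) U"
    by (rule kR.subspace_add[OF coeff_span_subspace])
  then show ?case using Z(1) by (auto simp: coeff_span_def)
qed

text \<open>
  Subrings of \<open>K\<close> that contain \<open>k\<close> and have finite dimension over it.  They are fields, because
  \<open>1 / v = (1 / v)^p v^(p - 1)\<close>.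
\<close>

definition finite_ext :: "'a set \<Rightarrow> bool" where
  "finite_ext V \<longleftrightarrow> 1 \<in> V \<and> (\<forall>v\<in>V. \<forall>w\<in>V. v * w \<in> V) \<and> (\<exists>S. finite S \<and> V = kK.span S)"

lemma finite_ext_subspace: "finite_ext V \<Longrightarrow> kK.subspace V"
  by (auto simp: finite_ext_def kK.subspace_span)

lemma finite_ext_mult: "finite_ext V \<Longrightarrow> v \<in> V \<Longrightarrow> w \<in> V \<Longrightarrow> v * w \<in> V" by (auto simp: finite_ext_def)

lemma finite_ext_pow: "finite_ext V \<Longrightarrow> v \<in> V \<Longrightarrow> v ^ n \<in> V"
  by (induction n) (auto simp: finite_ext_def)

lemma finite_ext_inverse:
  assumes V: "finite_ext V" "v \<in> V" shows "inverse v \<in> V"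
proof (cases "v = 0")
  case True then show ?thesis using V(2) by simp
next
  case False
  have "inverse v = inverse v ^ p * v ^ (p - 1)"
    using False p_pos by (cases p) (auto simp: field_simps)
  then show ?thesis
    using kK.subspace_scale[OF finite_ext_subspace[OF V(1)] finite_ext_pow[OF V], of "inverse v" "p - 1"] by (simp add: field_scale_def)
qed

lemma finite_ext_exists: "\<exists>V. finite_ext V"
proof
  show "finite_ext (kK.span {1})"
    unfolding finite_ext_def
    by (intro conjI exI[of _ "{1}"]) (auto simp: kK.span_singleton field_scale_def power_mult_distrib[symmetric] intro!: image_eqI[of _ _ 1])
qed

lemma finite_ext_adjoin1:
  assumes V: "finite_ext V" shows "\<exists>V'. finite_ext V' \<and> V \<subseteq> V' \<and> z \<in> V'"
proof -
  obtain S where S: "finite S" "V = kK.span S" using V by (auto simp: finite_ext_def)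
  define T where "T = (\<lambda>(s, i). s * z ^ i) ` (S \<times> {..<p})"
  define V' where "V' = kK.span T"
  have mem: "v * z ^ n \<in> V'" if "v \<in> V" for v n
    using that unfolding S(2)
  proof (induction rule: kK.span_induct_alt)
    case base then show ?case by (simp add: V'_def kK.span_zero)
  next
    case (step c x y)
    \<comment> \<open>Since \<open>z^p \<in> k\<close>, the exponent can be reduced modulo \<open>p\<close>.\<close>
    have e: "z ^ n = (z ^ (n div p)) ^ p * z ^ (n mod p)"
      by (metis mult.commute mult_div_mod_eq power_add power_mult)
    have "x * z ^ (n mod p) \<in> V'" unfolding V'_def T_def
      using step p_pos by (intro kK.span_base) force
    then have "field_scale (c * z ^ (n div p)) (x * z ^ (n mod p)) \<in> V'"
      unfolding V'_def by (rule kK.span_scale)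
    then have "field_scale c x * z ^ n \<in> V'"
      by (subst e) (simp add: field_scale_def power_mult_distrib mult_ac)
    then show ?case using step unfolding V'_def by (simp add: distrib_right kK.span_add)
  qed
  have mult: "a * b \<in> V'" if a: "a \<in> V'" and b: "b \<in> V'" for a b
    using a unfolding V'_def
  proof (induction rule: kK.span_induct_alt)
    case base then show ?case by (simp add: kK.span_zero)
  next
    case (step c x y)
    have "x * b \<in> V'" using b unfolding V'_def
    proof (induction rule: kK.span_induct_alt)
      case base then show ?case by (simp add: kK.span_zero)
    next
      case (step c' x' y')
      from \<open>x \<in> T\<close> \<open>x' \<in> T\<close> obtain s i s' i' where e: "x = s * z ^ i" "x' = s' * z ^ i'" "s \<in> S" "s' \<in> S"
        by (auto simp: T_def)
      have "s * s' * z ^ (i + i') \<in> V'"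
        using e(3,4) by (intro mem finite_ext_mult[OF V]) (auto simp: S(2) kK.span_base)
      then have "x * x' \<in> V'" unfolding e by (simp add: power_add mult_ac)
      then have "field_scale c' (x * x') + x * y' \<in> kK.span T"
        using step unfolding V'_def by (intro kK.span_add kK.span_scale)
      then show ?case by (simp add: distrib_left field_scale_mult)
    qed
    then have "field_scale c (x * b) + y * b \<in> kK.span T"
      using step unfolding V'_def by (intro kK.span_add kK.span_scale)
    then show ?case by (simp add: distrib_right field_scale_mult)
  qed
  have "1 \<in> V" using V by (simp add: finite_ext_def)
  have "finite T" using S(1) by (simp add: T_def)
  then have "\<exists>S. finite S \<and> V' = kK.span S" unfolding V'_def by blast
  moreover have "1 \<in> V'" using mem[OF \<open>1 \<in> V\<close>, of 0] by simp
  ultimately have "finite_ext V'" using mult unfolding finite_ext_def by blast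
  moreover have "V \<subseteq> V'" using mem[of _ 0] by auto
  moreover have "z \<in> V'" using mem[OF \<open>1 \<in> V\<close>, of 1] by simp
  ultimately show ?thesis by blast
qed

lemma finite_ext_adjoin:
  assumes "finite Z" "finite_ext V" shows "\<exists>V'. finite_ext V' \<and> V \<subseteq> V' \<and> Z \<subseteq> V'"
  using assms
proof (induction Z)
  case (insert z Z)
  then obtain V' where "finite_ext V'" "V \<subseteq> V'" "Z \<subseteq> V'" by auto
  then show ?case using finite_ext_adjoin1[of V' z] by blast
qed auto

lemma finite_basis:
  assumes "kR.subspace W" "W \<subseteq> kR.span S" "finite S"
  shows "\<exists>B. finite B \<and> B \<subseteq> W \<and> W = kR.span B"
proof -
  obtain B where B: "B \<subseteq> W" "kR.independent B" "W \<subseteq> kR.span B"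
    using kR.maximal_independent_subset by blast
  have "finite B" using kR.independent_span_bound[OF assms(3) B(2)] B(1) assms(2) by auto
  moreover have "kR.span B \<subseteq> W" using B(1) assms(1) by (rule kR.span_minimal)
  ultimately show ?thesis using B by auto
qed

end

section \<open>Filtrations and Noetherian graded modules\<close>

text \<open>
  A finite-dimensional filtration of \<open>K[x;d]\<close> over \<open>k\<close>.
\<close>

locale diff_poly_filtration = frobenius_derivation d p for d :: "'a::field \<Rightarrow> 'a" and p +
  fixes F :: "nat \<Rightarrow> 'a poly set"
  assumes F_subspace: "kR.subspace (F n)"
    and F_one: "1 \<in> F 0"
    and F_Suc: "F n \<subseteq> F (Suc n)"
    and F_mult: "f \<in> F i \<Longrightarrow> g \<in> F j \<Longrightarrow> f \<star> g \<in> F (i + j)"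
    and F_exhaustive: "\<exists>n. f \<in> F n"
    and F_finite: "\<exists>S. finite S \<and> F n \<subseteq> kR.span S"
begin

text \<open>
  The member preceding \<open>H n\<close>, with \<open>H (-1) = 0\<close>.
\<close>

definition below :: "(nat \<Rightarrow> 'a poly set) \<Rightarrow> nat \<Rightarrow> 'a poly set" where
  "below H n = (case n of 0 \<Rightarrow> {0} | Suc m \<Rightarrow> H m)"

text \<open>
  Filtered right modules over the filtered ring, consisting of \<open>k\<close>-subspaces of \<open>K[x]\<close>.
\<close>

definition filtered_module :: "(nat \<Rightarrow> 'a poly set) \<Rightarrow> bool" where
  "filtered_module H \<longleftrightarrow> (\<forall>n. kR.subspace (H n) \<and> H n \<subseteq> H (Suc n)) \<and>
     (\<forall>i j. \<forall>h\<in>H i. \<forall>r\<in>F j. h \<star> r \<in> H (i + j))"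

text \<open>
  A graded right \<open>gr F\<close>-submodule of \<open>gr H\<close>, given by the preimages \<open>I n\<close> of its components
  \<open>I n / H (n - 1)\<close> in \<open>H n\<close>.
\<close>

definition graded_submodule :: "(nat \<Rightarrow> 'a poly set) \<Rightarrow> (nat \<Rightarrow> 'a poly set) \<Rightarrow> bool" where
  "graded_submodule H I \<longleftrightarrow> (\<forall>n. kR.subspace (I n) \<and> below H n \<subseteq> I n \<and> I n \<subseteq> H n) \<and>
     (\<forall>i j. \<forall>h\<in>I i. \<forall>r\<in>F j. h \<star> r \<in> I (i + j))"

text \<open>
  With \<open>P = H (n - 1)\<close>, the preimage of the degree \<open>n\<close> component of the submodule that is generated
  by the components of \<open>I\<close> of degree at most \<open>N\<close>.
\<close>

definition generated_upto :: "'a poly set \<Rightarrow> (nat \<Rightarrow> 'a poly set) \<Rightarrow> nat \<Rightarrow> nat \<Rightarrow> 'a poly set" where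
  "generated_upto P I N n = kR.span (P \<union> {g \<star> r |g r j. j \<le> N \<and> j \<le> n \<and> g \<in> I j \<and> r \<in> F (n - j)})"

text \<open>
  Every graded submodule of \<open>gr H\<close> is generated in bounded degrees.  When the \<open>H n\<close> have finite
  dimension over \<open>k\<close>, this says that graded submodules are finitely generated.
\<close>

definition gr_noetherian :: "(nat \<Rightarrow> 'a poly set) \<Rightarrow> bool" where
  "gr_noetherian H \<longleftrightarrow> (\<forall>I. graded_submodule H I \<longrightarrow> (\<exists>N. \<forall>n. I n \<subseteq> generated_upto (below H n) I N n))"

lemma generated_upto_subspace: "kR.subspace (generated_upto P I N n)" by (simp add: generated_upto_def kR.subspace_span)

lemma generated_upto_base: "x \<in> P \<Longrightarrow> x \<in> generated_upto P I N n"
  unfolding generated_upto_def by (intro kR.span_base) auto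

lemma generated_upto_prod: "j \<le> N \<Longrightarrow> j \<le> n \<Longrightarrow> g \<in> I j \<Longrightarrow> r \<in> F (n - j) \<Longrightarrow> g \<star> r \<in> generated_upto P I N n"
  unfolding generated_upto_def by (intro kR.span_base) auto

lemma generated_upto_minimal:
  assumes "kR.subspace W" "P \<subseteq> W"
    "\<And>j g r. j \<le> N \<Longrightarrow> j \<le> n \<Longrightarrow> g \<in> I j \<Longrightarrow> r \<in> F (n - j) \<Longrightarrow> g \<star> r \<in> W"
  shows "generated_upto P I N n \<subseteq> W"
  unfolding generated_upto_def using assms by (intro kR.span_minimal) auto

lemma generated_upto_mono:
  assumes "P \<subseteq> P'" "\<And>j. I j \<subseteq> I' j" "N \<le> N'"
  shows "generated_upto P I N n \<subseteq> generated_upto P' I' N' n"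
proof (rule generated_upto_minimal[OF generated_upto_subspace])
  show "P \<subseteq> generated_upto P' I' N' n" using assms(1) by (auto intro: generated_upto_base)
  fix j g r assume "j \<le> N" "j \<le> n" "g \<in> I j" "r \<in> F (n - j)"
  then show "g \<star> r \<in> generated_upto P' I' N' n" using assms(2)[of j] assms(3) by (intro generated_upto_prod[of j]) auto
qed

lemma F_le: "i \<le> j \<Longrightarrow> F i \<subseteq> F j"
  using F_Suc by (rule lift_Suc_mono_le)

lemma filtered_module_F: "filtered_module F"
  unfolding filtered_module_def using F_subspace F_Suc F_mult by auto

lemma below_subset: "filtered_module H \<Longrightarrow> below H n \<subseteq> H n"
  by (cases n) (auto simp: below_def filtered_module_def kR.subspace_0)

lemma below_subspace: "filtered_module H \<Longrightarrow> kR.subspace (below H n)"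
  by (cases n) (auto simp: below_def filtered_module_def kR.subspace_single_0)

lemma below_mult:
  assumes H: "filtered_module H" "h \<in> below H i" "r \<in> F j" shows "h \<star> r \<in> below H (i + j)"
  using assms kR.subspace_0[OF below_subspace[OF H(1)]]
  by (cases i) (auto simp: below_def filtered_module_def dmult_0)

text \<open>
  The image of \<open>gr H\<close> in \<open>gr (H + c F)\<close> is a submodule with quotient an image of \<open>gr F\<close>.  In the proof,
  \<open>I1\<close> is the pullback of a given submodule to \<open>gr H\<close>, and \<open>I2\<close> is the pullback to \<open>gr F\<close> of its image in
  the quotient.
\<close>

lemma gr_noetherian_step:
  assumes noeth: "gr_noetherian H" "gr_noetherian F" and H: "filtered_module H"
  shows "gr_noetherian (\<lambda>n. {h + smult c f |h f. h \<in> H n \<and> f \<in> F n})" (is "gr_noetherian ?H'")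
  unfolding gr_noetherian_def
proof (intro allI impI)
  fix I assume I: "graded_submodule ?H' I"
  have I_sub: "kR.subspace (I n)" and I_below: "below ?H' n \<subseteq> I n" and I_H: "I n \<subseteq> ?H' n" for n
    using I by (auto simp: graded_submodule_def)
  have I_mult: "g \<star> r \<in> I (i + j)" if "g \<in> I i" "r \<in> F j" for g r i j
    using I that by (auto simp: graded_submodule_def)
  have H_sub: "kR.subspace (H n)" for n using H by (auto simp: filtered_module_def)
  have H_mult: "g \<star> r \<in> H (i + j)" if "g \<in> H i" "r \<in> F j" for g r i j
    using H that by (auto simp: filtered_module_def)
  have H_H': "below H n \<subseteq> below ?H' n" for n
    using kR.subspace_0[OF F_subspace] by (cases n) (force simp: below_def)+
  have F_H': "smult c f \<in> below ?H' n" if "f \<in> below F n" for f n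
    using kR.subspace_0[OF H_sub] that by (cases n) (force simp: below_def)+
  define I1 where "I1 = (\<lambda>n. I n \<inter> H n)"
  define Q where "Q = (\<lambda>n. {x + y |x y. x \<in> I n \<and> y \<in> H n})"
  define I2 where "I2 = (\<lambda>n. F n \<inter> {f. smult c f \<in> Q n})"
  have Q_sub: "kR.subspace (Q n)" for n
    unfolding Q_def by (intro kR.subspace_sums I_sub H_sub)
  have Q_I: "x \<in> I n \<Longrightarrow> x \<in> Q n" for x n
    unfolding Q_def using kR.subspace_0[OF H_sub] by force
  have Q_mult: "g \<star> r \<in> Q (i + j)" if "g \<in> Q i" "r \<in> F j" for g r i j
    using that I_mult H_mult unfolding Q_def by (fastforce simp: dmult_add_left)
  have "graded_submodule H I1" unfolding graded_submodule_def I1_def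
    using H_H' I_below below_subset[OF H] H_mult I_mult
    by (auto intro!: kR.subspace_inter I_sub H_sub)
  then obtain N1 where N1: "\<And>n. I1 n \<subseteq> generated_upto (below H n) I1 N1 n"
    using noeth(1) unfolding gr_noetherian_def by blast
  have "graded_submodule F I2" unfolding graded_submodule_def
  proof (intro conjI allI ballI)
    fix n show "kR.subspace (I2 n)" unfolding I2_def
      by (intro kR.subspace_inter F_subspace subspace_smult_vimage Q_sub)
    show "below F n \<subseteq> I2 n"
      using below_subset[OF filtered_module_F] F_H' I_below Q_I unfolding I2_def by blast
    show "I2 n \<subseteq> F n" by (auto simp: I2_def)
  next
    fix i j g r assume "g \<in> I2 i" "r \<in> F j"
    then show "g \<star> r \<in> I2 (i + j)"
      using F_mult Q_mult[of "smult c g" i r j] by (auto simp: I2_def dmult_smult)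
  qed
  then obtain N2 where N2: "\<And>n. I2 n \<subseteq> generated_upto (below F n) I2 N2 n"
    using noeth(2) unfolding gr_noetherian_def by blast
  define N where "N = max N1 N2"
  show "\<exists>N. \<forall>n. I n \<subseteq> generated_upto (below ?H' n) I N n"
  proof (intro exI[of _ N] allI subsetI)
    fix n u assume u: "u \<in> I n"
    let ?G = "generated_upto (below ?H' n) I N n"
    let ?S = "{x + y |x y. x \<in> ?G \<and> y \<in> H n}"
    have S_sub: "kR.subspace ?S" by (intro kR.subspace_sums generated_upto_subspace H_sub)
    have G_I: "?G \<subseteq> I n"
    proof (rule generated_upto_minimal[OF I_sub I_below])
      fix j g r assume "j \<le> n" "g \<in> I j" "r \<in> F (n - j)"
      then show "g \<star> r \<in> I n" using I_mult[of g j r "n - j"] by simp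
    qed
    obtain h f where hf: "u = h + smult c f" "h \<in> H n" "f \<in> F n" using u I_H by blast
    have "smult c f = u + (- h)" using hf(1) by simp
    then have "smult c f \<in> Q n"
      unfolding Q_def using u kR.subspace_neg[OF H_sub hf(2)] by blast
    with hf(3) have "f \<in> I2 n" by (simp add: I2_def)
    then have "f \<in> generated_upto (below F n) I2 N2 n" using N2 by blast
    also have "\<dots> \<subseteq> {f. smult c f \<in> ?S}"
    proof (rule generated_upto_minimal)
      show "below F n \<subseteq> {f. smult c f \<in> ?S}"
        using F_H' kR.subspace_0[OF H_sub] by (force intro: generated_upto_base)
      fix j g r assume j: "j \<le> N2" "j \<le> n" and g: "g \<in> I2 j" and r: "r \<in> F (n - j)"
      from g obtain x y where xy: "smult c g = x + y" "x \<in> I j" "y \<in> H j"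
        by (auto simp: I2_def Q_def)
      have "smult c (g \<star> r) = x \<star> r + y \<star> r" by (simp flip: dmult_smult dmult_add_left xy(1))
      moreover have "x \<star> r \<in> ?G" using j r xy(2) by (intro generated_upto_prod[of j]) (auto simp: N_def)
      moreover have "y \<star> r \<in> H n" using H_mult[OF xy(3) r] j by simp
      ultimately show "g \<star> r \<in> {f. smult c f \<in> ?S}" by blast
    qed (rule subspace_smult_vimage[OF S_sub])
    finally obtain s h' where s: "smult c f = s + h'" "s \<in> ?G" "h' \<in> H n" by blast
    have "u - s = h + h'" using hf(1) s(1) by simp
    then have "u - s \<in> I1 n"
      unfolding I1_def using kR.subspace_diff[OF I_sub u, of s] kR.subspace_add[OF H_sub hf(2) s(3)] s(2) G_I by auto
    then have "u - s \<in> generated_upto (below H n) I1 N1 n" using N1 by blast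
    also have "\<dots> \<subseteq> ?G" by (rule generated_upto_mono) (auto simp: H_H' I1_def N_def)
    finally have "(u - s) + s \<in> ?G" using s(2) by (intro kR.subspace_add[OF generated_upto_subspace])
    then show "u \<in> ?G" by simp
  qed
qed

lemma filtered_module_coeff_span: "filtered_module (\<lambda>n. coeff_span V (F n))"
  unfolding filtered_module_def
  using F_Suc by (auto intro!: coeff_span_subspace coeff_span_mono F_mult elim: coeff_span_dmult dest: subsetD[OF coeff_span_mono[OF order_refl F_Suc]])

lemma coeff_span_zero: "coeff_span V {0} = {0}"
  using coeff_span_minimal[of "{0}" V "{0}"] kR.subspace_0[OF coeff_span_subspace[of V "{0}"]] kR.subspace_single_0 by auto

lemma below_coeff_span: "below (\<lambda>n. coeff_span V (F n)) n = coeff_span V (below F n)"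
  by (cases n) (auto simp: below_def coeff_span_zero)

lemma coeff_span_empty: "coeff_span {} U = {0}"
  by (simp add: coeff_span_def)

lemma coeff_span_insert:
  assumes U: "kR.subspace U"
  shows "coeff_span (insert c S) U = {h + smult c f |h f. h \<in> coeff_span S U \<and> f \<in> U}" (is "_ = ?R")
proof
  have "?R = {x + y |x y. x \<in> coeff_span S U \<and> y \<in> smult c ` U}" by auto
  moreover have "kR.subspace (smult c ` U)"
  proof (rule kR.subspaceI)
    show "0 \<in> smult c ` U" using kR.subspace_0[OF U] by force
    fix x y assume "x \<in> smult c ` U" "y \<in> smult c ` U"
    then show "x + y \<in> smult c ` U" using kR.subspace_add[OF U] by (auto simp flip: smult_add_right)
  next
    fix a x assume "x \<in> smult c ` U"
    then obtain u where "x = smult c u" "u \<in> U" by auto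
    then show "poly_scale a x \<in> smult c ` U"
      using kR.subspace_scale[OF U, of u a] by (auto simp: poly_scale_def mult.commute intro!: image_eqI[of _ _ "smult (a ^ p) u"])
  qed
  ultimately have R: "kR.subspace ?R" using kR.subspace_sums[OF coeff_span_subspace[of S U]] by simp
  show "coeff_span (insert c S) U \<subseteq> ?R"
  proof (rule coeff_span_minimal[OF R])
    fix v u assume v: "v \<in> insert c S" and u: "u \<in> U"
    show "smult v u \<in> ?R"
    proof (cases "v = c")
      case True then show ?thesis using u kR.subspace_0[OF coeff_span_subspace[of S U]] by force
    next
      case False
      then have "smult v u \<in> coeff_span S U" using v u by (intro coeff_span_base) auto
      then show ?thesis using kR.subspace_0[OF U] by force
    qed
  qed
  show "?R \<subseteq> coeff_span (insert c S) U"
    using coeff_span_mono[of S "insert c S" U U] by (auto intro!: kR.subspace_add[OF coeff_span_subspace] coeff_span_base)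
qed

lemma coeff_span_span:
  assumes "kR.subspace U" shows "coeff_span (kK.span S) U = coeff_span S U"
proof
  show "coeff_span (kK.span S) U \<subseteq> coeff_span S U"
  proof (rule coeff_span_minimal[OF coeff_span_subspace])
    fix v u assume "v \<in> kK.span S" and u: "u \<in> U"
    then show "smult v u \<in> coeff_span S U"
    proof (induction rule: kK.span_induct_alt)
      case base then show ?case by (simp add: kR.subspace_0[OF coeff_span_subspace])
    next
      case (step c x y)
      have "poly_scale c (smult x u) \<in> coeff_span S U"
        using step u by (intro kR.subspace_scale[OF coeff_span_subspace] coeff_span_base)
      moreover have "smult (field_scale c x + y) u = poly_scale c (smult x u) + smult y u"
        by (simp add: poly_scale_def field_scale_def smult_add_left)
      ultimately show ?case using step u by (simp add: kR.subspace_add[OF coeff_span_subspace])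
    qed
  qed
qed (intro coeff_span_mono kK.span_superset order_refl)

lemma gr_noetherian_coeff_span_finite:
  assumes F: "gr_noetherian F" and "finite S" shows "gr_noetherian (\<lambda>n. coeff_span S (F n))"
  using assms(2)
proof induction
  case empty
  have "graded_submodule (\<lambda>n. {0}) I \<Longrightarrow> I n \<subseteq> generated_upto (below (\<lambda>n. {0}) n) I 0 n" for I n
  proof
    fix x assume "graded_submodule (\<lambda>n. {0}) I" "x \<in> I n"
    then have "x = 0" by (auto simp: graded_submodule_def)
    then show "x \<in> generated_upto (below (\<lambda>n. {0}) n) I 0 n" by (simp add: kR.subspace_0[OF generated_upto_subspace])
  qed
  then show ?case by (auto simp: coeff_span_empty gr_noetherian_def)
next
  case (insert c S)
  show ?case using gr_noetherian_step[OF insert(3) F filtered_module_coeff_span, of c]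
    by (simp add: coeff_span_insert[OF F_subspace])
qed

lemma gr_noetherian_coeff_span: "gr_noetherian F \<Longrightarrow> finite_ext V \<Longrightarrow> gr_noetherian (\<lambda>n. coeff_span V (F n))"
  using gr_noetherian_coeff_span_finite by (auto simp: finite_ext_def coeff_span_span[OF F_subspace])

lemma finite_span_coeff_span: "finite_ext V \<Longrightarrow> \<exists>S. finite S \<and> coeff_span V (F n) \<subseteq> kR.span S"
proof -
  assume "finite_ext V"
  then obtain S where S: "finite S" "V = kK.span S" by (auto simp: finite_ext_def)
  obtain T where T: "finite T" "F n \<subseteq> kR.span T" using F_finite by blast
  let ?B = "(\<lambda>(s, t). smult s t) ` (S \<times> T)"
  have "coeff_span V (F n) = coeff_span S (F n)" by (simp add: S coeff_span_span[OF F_subspace])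
  also have "\<dots> \<subseteq> kR.span ?B"
  proof (rule coeff_span_minimal[OF kR.subspace_span])
    fix s f assume s: "s \<in> S" and "f \<in> F n"
    then have "f \<in> kR.span T" using T by auto
    also have "\<dots> \<subseteq> {f. smult s f \<in> kR.span ?B}"
      by (intro kR.span_minimal subspace_smult_vimage kR.subspace_span) (use s in \<open>auto intro!: kR.span_base\<close>)
    finally show "smult s f \<in> kR.span ?B" by simp
  qed
  finally show ?thesis using S T by (intro exI[of _ ?B]) auto
qed

section \<open>The slope of a filtration\<close>

lemma F_degree_bounded: "\<exists>D. \<forall>f\<in>F n. degree f \<le> D"
proof -
  obtain S where S: "finite S" "F n \<subseteq> kR.span S" using F_finite by blast
  define D where "D = Max (insert 0 (degree ` S))"
  have "kR.span S \<subseteq> {f. degree f \<le> D}"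
  proof (intro kR.span_minimal kR.subspaceI)
    fix c and f :: "'a poly" assume "f \<in> {f. degree f \<le> D}"
    then show "poly_scale c f \<in> {f. degree f \<le> D}" by (simp add: poly_scale_def)
  qed (use S in \<open>auto simp: D_def intro: degree_add_le\<close>)
  then show ?thesis using S by auto
qed

text \<open>
  An element of positive degree in \<open>F 0\<close> would have powers of unbounded degree in \<open>F 0\<close>.
\<close>

lemma F0_degree: "f \<in> F 0 \<Longrightarrow> degree f = 0"
proof (rule ccontr)
  assume f: "f \<in> F 0" "degree f \<noteq> 0"
  have pow: "\<exists>g\<in>F 0. g \<noteq> 0 \<and> degree g = n * degree f" for n
  proof (induction n)
    case 0 show ?case using F_one by (intro bexI[of _ 1]) auto
  next
    case (Suc n)
    then obtain g where g: "g \<in> F 0" "g \<noteq> 0" "degree g = n * degree f" by auto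
    have "f \<noteq> 0" using f by auto
    then show ?case using diff_poly_mult_degree[OF deriv _ g(2)] F_mult[OF f(1) g(1)] g by (intro bexI[of _ "f \<star> g"]) auto
  qed
  obtain D where D: "\<forall>f\<in>F 0. degree f \<le> D" using F_degree_bounded by blast
  from pow[of "Suc D"] D f have "Suc D * degree f \<le> D" by force
  with f(2) show False by (cases "degree f") auto
qed

lemma graded_submodule_positive: "graded_submodule F (\<lambda>n. if n = 0 then {0} else F n)"
  unfolding graded_submodule_def below_def using F_subspace F_mult F_Suc kR.subspace_0[OF F_subspace]
  by (auto simp: kR.subspace_single_0 dmult_0 split: nat.splits)

text \<open>
  If \<open>gr F\<close> is generated in degrees at most \<open>N\<close>, then the maximal ratio of the \<open>x\<close>-degree to the filtration
  degree over the degrees \<open>1, \<dots>, N + 1\<close> bounds this ratio in every degree.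
\<close>

lemma slope_exists:
  assumes noeth: "gr_noetherian F"
  shows "\<exists>m q w. m > 0 \<and> q > 0 \<and> w \<in> F m \<and> degree w = q \<and> (\<forall>n. \<forall>f\<in>F n. m * degree f \<le> q * n)"
proof -
  define I where "I = (\<lambda>n. if n = 0 then {0} else F n)"
  have "graded_submodule F I" unfolding I_def by (rule graded_submodule_positive)
  then obtain N where N: "\<And>n. I n \<subseteq> generated_upto (below F n) I N n"
    using noeth unfolding gr_noetherian_def by blast
  define e where "e = (\<lambda>n. Max (degree ` F n))"
  have fin: "finite (degree ` F n)" for n
  proof -
    obtain D where "\<forall>f\<in>F n. degree f \<le> D" using F_degree_bounded[of n] by blast
    then have "degree ` F n \<subseteq> {..D}" by blast
    then show ?thesis by (rule finite_subset) simp
  qed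
  have e: "degree f \<le> e n" if "f \<in> F n" for f n
    unfolding e_def using that fin by (intro Max_ge imageI)
  have e_ex: "\<exists>f\<in>F n. degree f = e n" for n
  proof -
    have "F n \<noteq> {}" using kR.subspace_0[OF F_subspace[of n]] by blast
    then have "e n \<in> degree ` F n" unfolding e_def using fin by (intro Max_in) auto
    then show ?thesis by force
  qed
  \<comment> \<open>\<open>Suc N\<close> instead of \<open>N\<close>, so that the range of \<open>j\<close> is nonempty.\<close>
  let ?r = "\<lambda>j. real (e j) / real j"
  have "Max (?r ` {1..Suc N}) \<in> ?r ` {1..Suc N}" by (intro Max_in) auto
  then obtain m where m: "m \<in> {1..Suc N}" "Max (?r ` {1..Suc N}) = ?r m" by blast
  have ratio: "m * e j \<le> e m * j" if "1 \<le> j" "j \<le> N" for j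
  proof -
    have "?r j \<le> ?r m" unfolding m(2)[symmetric] using that by (intro Max_ge) auto
    then have "real (m * e j) \<le> real (e m * j)" using that m(1) by (simp add: field_simps)
    then show ?thesis by (simp only: of_nat_le_iff)
  qed
  have bound: "m * degree f \<le> e m * n" if "f \<in> F n" for n f
    using that
  proof (induction n arbitrary: f rule: less_induct)
    case (less n)
    show ?case
    proof (cases n)
      case 0 then show ?thesis using less.prems F0_degree by simp
    next
      case (Suc n')
      let ?W = "{f :: 'a poly. m * degree f \<le> e m * n}"
      have "kR.subspace ?W"
      proof (rule kR.subspaceI)
        fix x y assume "x \<in> ?W" "y \<in> ?W"
        moreover have "degree (x + y) \<le> degree x \<or> degree (x + y) \<le> degree y"
          using degree_add_le_max[of x y] by (auto simp: max_def split: if_splits)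
        then have "m * degree (x + y) \<le> m * degree x \<or> m * degree (x + y) \<le> m * degree y"
          using mult_le_mono2 by blast
        ultimately show "x + y \<in> ?W" unfolding mem_Collect_eq by linarith
      qed (auto simp: poly_scale_def)
      then have "generated_upto (below F n) I N n \<subseteq> ?W"
      proof (rule generated_upto_minimal)
        have "m * degree f \<le> e m * n" if "f \<in> F n'" for f
          using less.IH[of n' f] that Suc by (simp add: trans_le_add2)
        then show "below F n \<subseteq> ?W" using Suc by (auto simp: below_def)
        fix j g r assume j: "j \<le> N" "j \<le> n" "g \<in> I j" "r \<in> F (n - j)"
        show "g \<star> r \<in> ?W"
        proof (cases "j = 0")
          case True then show ?thesis using j by (simp add: I_def dmult_0)
        next
          case False
          with j have g: "degree g \<le> e j" "m * e j \<le> e m * j"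
            using e[of g j] ratio[of j] by (simp_all add: I_def)
          then have "m * degree g \<le> e m * j" using mult_le_mono2[OF g(1), of m] by linarith
          moreover have "m * degree r \<le> e m * (n - j)" using less.IH[of "n - j" r] j False by auto
          ultimately have "m * (degree g + degree r) \<le> e m * j + e m * (n - j)" by (simp add: distrib_left)
          also have "\<dots> = e m * n" using j by (simp flip: distrib_left)
          finally have "m * (degree g + degree r) \<le> e m * n" .
          moreover have "degree (g \<star> r) \<le> degree g + degree r"
            by (rule diff_poly_mult_coeff(1)[OF deriv order_refl order_refl])
          then have "m * degree (g \<star> r) \<le> m * (degree g + degree r)" by (rule mult_le_mono2)
          ultimately show ?thesis unfolding mem_Collect_eq by linarith
        qed
      qed
      then show ?thesis using N[of n] less.prems Suc by (auto simp: I_def)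
    qed
  qed
  obtain w where w: "w \<in> F m" "degree w = e m" using e_ex by blast
  obtain n where "[:0, 1:] \<in> F n" using F_exhaustive by blast
  from bound[OF this] m(1) have "e m > 0" by (cases "e m") auto
  then show ?thesis using w m(1) bound by (intro exI[of _ m] exI[of _ "e m"] exI[of _ w]) auto
qed

end

section \<open>Defects and their coefficients\<close>

text \<open>
  A filtration with Noetherian graded ring, together with its slope \<open>q / m\<close> and an element \<open>w\<close> that
  attains it.
\<close>

locale sloped_filtration = diff_poly_filtration d p F
  for d :: "'a::field \<Rightarrow> 'a" and p F +
  fixes m q :: nat and w :: "'a poly"
  assumes noeth: "gr_noetherian F"
    and m_pos: "m > 0" and q_pos: "q > 0"
    and w: "w \<in> F m" "degree w = q"
    and slope: "f \<in> F n \<Longrightarrow> m * degree f \<le> q * n"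
begin

text \<open>
  In filtration degree \<open>n\<close>, the defect of a nonzero polynomial of degree \<open>i\<close> is \<open>q n - m i\<close>.  The set
  \<open>defect_ge n c\<close> consists of \<open>0\<close> and the polynomials of defect at least \<open>c\<close>.
\<close>

definition defect_ge :: "nat \<Rightarrow> nat \<Rightarrow> 'a poly set" where
  "defect_ge n c = {y. y = 0 \<or> m * degree y + c \<le> q * n}"

text \<open>
  The coefficient of \<open>y\<close> at the exponent \<open>i\<close> of defect exactly \<open>c\<close>, that is, with \<open>m i + c = q n\<close>; it is \<open>0\<close> if
  there is no such exponent.  For \<open>y\<close> in \<open>defect_ge n c\<close> it vanishes if and only if \<open>y\<close> is in
  \<open>defect_ge n (c + 1)\<close>.
\<close>

definition defect_coeff :: "nat \<Rightarrow> nat \<Rightarrow> 'a poly \<Rightarrow> 'a" where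
  "defect_coeff n c y = (let i = (q * n - c) div m in if m * i + c = q * n then coeff y i else 0)"

lemma defect_coeff_eq: "m * i + c = q * n \<Longrightarrow> defect_coeff n c y = coeff y i"
proof -
  assume i: "m * i + c = q * n"
  then have "q * n - c = m * i" by linarith
  then have "(q * n - c) div m = i" using m_pos by simp
  then show ?thesis using i by (simp add: defect_coeff_def)
qed

lemma defect_coeff_none: "(\<And>i. m * i + c \<noteq> q * n) \<Longrightarrow> defect_coeff n c y = 0"
  by (simp add: defect_coeff_def Let_def)

lemma defect_coeff_0: "defect_coeff n c 0 = 0"
  and defect_coeff_add: "defect_coeff n c (x + y) = defect_coeff n c x + defect_coeff n c y"
  and defect_coeff_smult: "defect_coeff n c (smult a y) = a * defect_coeff n c y"
  by (simp_all add: defect_coeff_def Let_def)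

lemma defect_ge_0: "0 \<in> defect_ge n c" by (simp add: defect_ge_def)

lemma defect_ge_add: "x \<in> defect_ge n c \<Longrightarrow> y \<in> defect_ge n c \<Longrightarrow> x + y \<in> defect_ge n c"
proof -
  assume x: "x \<in> defect_ge n c" and y: "y \<in> defect_ge n c"
  show "x + y \<in> defect_ge n c"
  proof (cases "x = 0 \<or> y = 0")
    case False
    have "degree (x + y) \<le> degree x \<or> degree (x + y) \<le> degree y"
      using degree_add_le_max[of x y] by (auto simp: max_def split: if_splits)
    then have "m * degree (x + y) \<le> m * degree x \<or> m * degree (x + y) \<le> m * degree y"
      using mult_le_mono2 by blast
    moreover have "m * degree x + c \<le> q * n" "m * degree y + c \<le> q * n" using x y False by (auto simp: defect_ge_def)
    ultimately have "m * degree (x + y) + c \<le> q * n" by linarith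
    then show ?thesis by (simp add: defect_ge_def)
  qed (use x y in auto)
qed

lemma defect_ge_smult: "y \<in> defect_ge n c \<Longrightarrow> smult a y \<in> defect_ge n c"
  by (auto simp: defect_ge_def)

lemma defect_ge_subspace: "kR.subspace (defect_ge n c)"
  by (intro kR.subspaceI defect_ge_0 defect_ge_add) (auto simp: poly_scale_def defect_ge_smult)

lemma F_defect_ge: "f \<in> F n \<Longrightarrow> f \<in> defect_ge n 0"
  using slope by (simp add: defect_ge_def)

lemma defect_coeff_lower: "y \<in> defect_ge n (Suc c) \<Longrightarrow> defect_coeff n c y = 0"
proof (cases "\<exists>i. m * i + c = q * n")
  case True
  then obtain i where i: "m * i + c = q * n" by auto
  assume "y \<in> defect_ge n (Suc c)"
  then have "y = 0 \<or> m * degree y + Suc c \<le> m * i + c" by (simp add: defect_ge_def i)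
  then have "y = 0 \<or> m * degree y < m * i" by linarith
  then have "coeff y i = 0" by (auto intro: coeff_eq_0)
  then show ?thesis by (simp add: defect_coeff_eq[OF i])
qed (auto intro: defect_coeff_none)

lemma defect_ge_drop:
  assumes y: "y \<in> defect_ge n c" and t: "defect_coeff n c y = 0" shows "y \<in> defect_ge n (Suc c)"
proof (rule ccontr)
  assume "y \<notin> defect_ge n (Suc c)"
  with y have y0: "y \<noteq> 0" and e: "m * degree y + c = q * n" by (auto simp: defect_ge_def)
  from t y0 show False by (simp add: defect_coeff_eq[OF e])
qed

lemma defect_ge_mult:
  assumes y: "y \<in> defect_ge n c" and r: "r \<in> defect_ge l 0"
  shows "y \<star> r \<in> defect_ge (n + l) c"
    and "defect_coeff (n + l) c (y \<star> r) = defect_coeff n c y * defect_coeff l 0 r"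
proof -
  have "y \<star> r \<in> defect_ge (n + l) c \<and> defect_coeff (n + l) c (y \<star> r) = defect_coeff n c y * defect_coeff l 0 r"
  proof (cases "y = 0 \<or> r = 0")
    case True
    then show ?thesis by (auto simp: dmult_0 dmult_0_right defect_ge_0 defect_coeff_0)
  next
    case False
    then have y0: "y \<noteq> 0" "m * degree y + c \<le> q * n" and r0: "r \<noteq> 0" "m * degree r + 0 \<le> q * l"
      using y r by (auto simp: defect_ge_def)
    note D = diff_poly_mult_degree[OF deriv y0(1) r0(1)]
    have e: "m * degree (y \<star> r) + c = (m * degree y + c) + m * degree r" by (simp add: D distrib_left)
    have mem: "y \<star> r \<in> defect_ge (n + l) c" unfolding defect_ge_def using y0 r0 e by (simp add: distrib_left)
    show ?thesis
    proof (cases "m * degree y + c = q * n \<and> m * degree r + 0 = q * l")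
      case True
      then have i: "m * (degree y + degree r) + c = q * (n + l)" by (simp add: distrib_left)
      have "defect_coeff (n + l) c (y \<star> r) = coeff y (degree y) * coeff r (degree r)"
        unfolding defect_coeff_eq[OF i] by (rule diff_poly_mult_coeff(2)[OF deriv order_refl order_refl])
      then show ?thesis using mem True by (simp add: defect_coeff_eq[of "degree y"] defect_coeff_eq[of "degree r"])
    next
      case False
      then have lt: "m * degree y + Suc c \<le> q * n \<or> m * degree r + Suc 0 \<le> q * l" using y0 r0 by linarith
      then have "y \<in> defect_ge n (Suc c) \<or> r \<in> defect_ge l (Suc 0)" by (auto simp: defect_ge_def)
      then have z: "defect_coeff n c y * defect_coeff l 0 r = 0" using defect_coeff_lower by auto
      have "m * degree (y \<star> r) + Suc c \<le> q * (n + l)" using lt e y0 r0 by (auto simp: distrib_left)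
      then have "y \<star> r \<in> defect_ge (n + l) (Suc c)" by (simp add: defect_ge_def)
      then show ?thesis using mem z defect_coeff_lower by simp
    qed
  qed
  then show "y \<star> r \<in> defect_ge (n + l) c" "defect_coeff (n + l) c (y \<star> r) = defect_coeff n c y * defect_coeff l 0 r" by auto
qed

text \<open>
  The left \<open>K\<close>-space \<open>K F\<^bsub>n-1\<^esub>\<close>.
\<close>

definition KF_below :: "nat \<Rightarrow> 'a poly set" where "KF_below n = coeff_span UNIV (below F n)"

lemma KF_below_subspace: "kR.subspace (KF_below n)" by (simp add: KF_below_def coeff_span_subspace)
lemma KF_below_smult: "g \<in> KF_below n \<Longrightarrow> smult a g \<in> KF_below n" unfolding KF_below_def by (rule coeff_span_smult) auto
lemma KF_below_mult: "g \<in> KF_below i \<Longrightarrow> r \<in> F j \<Longrightarrow> g \<star> r \<in> KF_below (i + j)"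
  unfolding KF_below_def by (erule coeff_span_dmult) (rule below_mult[OF filtered_module_F])
lemma F_KF_below: "f \<in> F i \<Longrightarrow> i < n \<Longrightarrow> f \<in> KF_below n"
  using coeff_span_base[of 1 UNIV f "below F n"] F_le[of i "n - 1"] by (cases n) (auto simp: KF_below_def below_def)

text \<open>
  Every degree \<open>i = a + b q\<close> with \<open>a < q\<close> is the degree of \<open>x^a w^b\<close>.  If \<open>x^a \<in> F\<^sub>l\<close>, this product lies in
  \<open>F\<^sub>n\<close> for \<open>n = l + b m\<close>, where its defect is the defect \<open>q l - m a\<close> of \<open>x^a\<close>, whatever \<open>b\<close> is.  So polynomials whose
  defect exceeds all of these are reduced to \<open>0\<close> by subtracting \<open>K\<close>-multiples of elements of earlier members of the filtration.
\<close>

lemma defect_ge_large: "\<exists>C. \<forall>n. defect_ge n (Suc C) \<subseteq> KF_below n"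
proof -
  have "\<exists>n. monom 1 a \<in> F n" for a using F_exhaustive by blast
  then obtain N where N: "\<And>a. monom 1 a \<in> F (N a)" by metis
  define C where "C = q * (\<Sum>a<q. N a)"
  have mono: "\<exists>g n. g \<in> F n \<and> g \<noteq> 0 \<and> degree g = i \<and> q * n \<le> m * i + C" for i
  proof (induction i rule: less_induct)
    case (less i)
    show ?case
    proof (cases "i < q")
      case True
      then have "N i \<le> (\<Sum>a<q. N a)" by (intro member_le_sum) auto
      then have "q * N i \<le> C" unfolding C_def by (rule mult_le_mono2)
      then show ?thesis using N[of i] by (intro exI[of _ "monom 1 i"] exI[of _ "N i"]) (auto simp: degree_monom_eq)
    next
      case False
      then obtain g n where g: "g \<in> F n" "g \<noteq> 0" "degree g = i - q" "q * n \<le> m * (i - q) + C"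
        using less[of "i - q"] q_pos by auto
      have "w \<noteq> 0" using w(2) q_pos by auto
      note D = diff_poly_mult_degree[OF deriv g(2) this]
      have "m * (i - q) + m * q = m * i" using False by (simp flip: distrib_left)
      then have "q * (n + m) \<le> m * i + C" using g(4) by (simp add: distrib_left mult.commute)
      then show ?thesis using F_mult[OF g(1) w(1)] D False g(3) w(2)
        by (intro exI[of _ "g \<star> w"] exI[of _ "n + m"]) auto
    qed
  qed
  have "y \<in> defect_ge n (Suc C) \<Longrightarrow> y \<in> KF_below n" for n y
  proof (induction "if y = 0 then 0 else Suc (degree y)" arbitrary: y rule: less_induct)
    case (less y)
    show ?case
    proof (cases "y = 0")
      case True then show ?thesis by (simp add: kR.subspace_0[OF KF_below_subspace])
    next
      case False
      obtain g l where g: "g \<in> F l" "g \<noteq> 0" "degree g = degree y" "q * l \<le> m * degree y + C"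
        using mono by blast
      have "m * degree y + Suc C \<le> q * n" using less.prems False by (simp add: defect_ge_def)
      then have "q * l < q * n" using g(4) by linarith
      then have "g \<in> KF_below n" using g(1) by (intro F_KF_below) auto
      define a where "a = lead_coeff y / lead_coeff g"
      have gX: "smult (- a) g \<in> defect_ge n (Suc C)" using g(3) less.prems False by (auto simp: defect_ge_def)
      define z where "z = y + smult (- a) g"
      have zX: "z \<in> defect_ge n (Suc C)" unfolding z_def by (rule defect_ge_add[OF less.prems gX])
      have "coeff g (degree y) \<noteq> 0" using g(2) by (simp flip: g(3))
      then have cz: "coeff z (degree y) = 0" by (simp add: z_def a_def g(3))
      have "degree z \<le> degree y" unfolding z_def using g(3) by (intro degree_add_le) (auto intro: order_trans[OF degree_smult_le])
      then have "z = 0 \<or> degree z < degree y"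
        using cz by (metis leading_coeff_0_iff le_neq_implies_less)
      then have "z \<in> KF_below n" using less.hyps[of z] zX False by auto
      then have "z + smult a g \<in> KF_below n"
        using KF_below_smult[OF \<open>g \<in> KF_below n\<close>, of a] by (rule kR.subspace_add[OF KF_below_subspace])
      then show ?thesis by (simp add: z_def)
    qed
  qed
  then show ?thesis by blast
qed

text \<open>
  The sum of \<open>K F\<^bsub>n-1\<^esub>\<close> and the polynomials of defect at least \<open>c\<close>.
\<close>

definition KF_defect_ge :: "nat \<Rightarrow> nat \<Rightarrow> 'a poly set" where
  "KF_defect_ge n c = {g + y |g y. g \<in> KF_below n \<and> y \<in> defect_ge n c}"

text \<open>
  Modulo \<open>K F\<^bsub>n-1\<^esub>\<close> the polynomial \<open>f\<close> has defect at least \<open>c\<close>, with coefficient \<open>a\<close> at defect \<open>c\<close>.  This is a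
  relation because \<open>a\<close> may depend on the representative modulo \<open>K F\<^bsub>n-1\<^esub>\<close>.
\<close>

definition has_defect_coeff :: "nat \<Rightarrow> nat \<Rightarrow> 'a poly \<Rightarrow> 'a \<Rightarrow> bool" where
  "has_defect_coeff n c f a \<longleftrightarrow> (\<exists>g y. f = g + y \<and> g \<in> KF_below n \<and> y \<in> defect_ge n c \<and> defect_coeff n c y = a)"

lemma KF_defect_ge_subspace: "kR.subspace (KF_defect_ge n c)"
  unfolding KF_defect_ge_def by (intro kR.subspace_sums KF_below_subspace defect_ge_subspace)

lemma KF_defect_ge_smult: "f \<in> KF_defect_ge n c \<Longrightarrow> smult a f \<in> KF_defect_ge n c"
  unfolding KF_defect_ge_def using KF_below_smult defect_ge_smult by (force simp: smult_add_right)

lemma KF_defect_ge_iff: "f \<in> KF_defect_ge n c \<longleftrightarrow> (\<exists>a. has_defect_coeff n c f a)"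
  by (auto simp: KF_defect_ge_def has_defect_coeff_def)

lemma has_defect_coeff_KF_below: "f \<in> KF_below n \<Longrightarrow> has_defect_coeff n c f 0"
  unfolding has_defect_coeff_def by (intro exI[of _ f] exI[of _ 0]) (auto simp: defect_ge_0 defect_coeff_0)

lemma KF_below_defect_ge: "f \<in> KF_below n \<Longrightarrow> f \<in> KF_defect_ge n c"
  using has_defect_coeff_KF_below KF_defect_ge_iff by blast

lemma has_defect_coeff_add: "has_defect_coeff n c f a \<Longrightarrow> has_defect_coeff n c g b \<Longrightarrow> has_defect_coeff n c (f + g) (a + b)"
proof -
  assume "has_defect_coeff n c f a" "has_defect_coeff n c g b"
  then obtain f1 f2 g1 g2 where *: "f = f1 + f2" "f1 \<in> KF_below n" "f2 \<in> defect_ge n c" "defect_coeff n c f2 = a"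
     "g = g1 + g2" "g1 \<in> KF_below n" "g2 \<in> defect_ge n c" "defect_coeff n c g2 = b" unfolding has_defect_coeff_def by blast
  have "f + g = (f1 + g1) + (f2 + g2)" by (simp add: *)
  moreover have "f1 + g1 \<in> KF_below n" using * by (intro kR.subspace_add[OF KF_below_subspace])
  ultimately show ?thesis unfolding has_defect_coeff_def using * defect_ge_add defect_coeff_add by blast
qed

lemma has_defect_coeff_smult: "has_defect_coeff n c f a \<Longrightarrow> has_defect_coeff n c (smult b f) (b * a)"
  unfolding has_defect_coeff_def using KF_below_smult defect_ge_smult defect_coeff_smult smult_add_right by metis

lemma has_defect_coeff_mult: "has_defect_coeff n c f a \<Longrightarrow> r \<in> F l \<Longrightarrow> has_defect_coeff (n + l) c (f \<star> r) (a * defect_coeff l 0 r)"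
proof -
  assume "has_defect_coeff n c f a" and r: "r \<in> F l"
  then obtain g y where *: "f = g + y" "g \<in> KF_below n" "y \<in> defect_ge n c" "defect_coeff n c y = a" unfolding has_defect_coeff_def by blast
  have "f \<star> r = g \<star> r + y \<star> r" by (simp add: * dmult_add_left)
  moreover have "g \<star> r \<in> KF_below (n + l)" using * r by (intro KF_below_mult)
  moreover note defect_ge_mult[OF *(3) F_defect_ge[OF r]]
  ultimately show ?thesis unfolding has_defect_coeff_def using *(4) by blast
qed

lemma has_defect_coeff_0: "has_defect_coeff n c f 0 \<Longrightarrow> f \<in> KF_defect_ge n (Suc c)"
  unfolding has_defect_coeff_def KF_defect_ge_def using defect_ge_drop by blast

lemma KF_defect_ge_mult: "f \<in> KF_defect_ge n c \<Longrightarrow> r \<in> F l \<Longrightarrow> f \<star> r \<in> KF_defect_ge (n + l) c"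
  using KF_defect_ge_iff has_defect_coeff_mult by blast

lemma KF_defect_ge_Suc: "KF_defect_ge n (Suc c) \<subseteq> KF_defect_ge n c"
  unfolding KF_defect_ge_def defect_ge_def by fastforce

lemma has_defect_coeff_span:
  assumes V: "kK.subspace V" and B: "\<And>b. b \<in> B \<Longrightarrow> \<exists>a\<in>V. has_defect_coeff n c b a" and f: "f \<in> kR.span B"
  shows "\<exists>a\<in>V. has_defect_coeff n c f a"
  using f
proof (induction rule: kR.span_induct_alt)
  case base
  have "has_defect_coeff n c 0 0" using has_defect_coeff_KF_below kR.subspace_0[OF KF_below_subspace] by blast
  then show ?case using kK.subspace_0[OF V] by blast
next
  case (step e x y)
  then obtain a b where ab: "a \<in> V" "has_defect_coeff n c x a" "b \<in> V" "has_defect_coeff n c y b" using B by blast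
  have "field_scale e a + b \<in> V" using ab by (intro kK.subspace_add[OF V] kK.subspace_scale[OF V])
  moreover have "has_defect_coeff n c (poly_scale e x + y) (field_scale e a + b)"
    unfolding poly_scale_def field_scale_def using ab by (intro has_defect_coeff_add has_defect_coeff_smult)
  ultimately show ?case by blast
qed

section \<open>Descent to a finite extension\<close>

lemma defect_coeff_subspace: "kK.subspace V \<Longrightarrow> kR.subspace {f. defect_coeff n c f \<in> V}"
  by (intro kR.subspaceI)
    (auto simp: defect_coeff_0 defect_coeff_add defect_coeff_smult poly_scale_def kK.subspace_0 kK.subspace_add simp flip: field_scale_def intro: kK.subspace_scale)

lemma F_basis: "\<exists>B. finite B \<and> B \<subseteq> F n \<and> F n = kR.span B"
  using F_finite[of n] finite_basis[OF F_subspace] by blast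

text \<open>
  At defect \<open>0\<close> the coefficient is multiplicative.  Since the positive part of \<open>gr F\<close> is generated in
  degrees at most \<open>N\<close>, all coefficients lie in the ring generated over \<open>k\<close> by those from \<open>F\<^sub>0, \<dots>, F\<^sub>N\<close>.
\<close>

lemma defect_coeff_extension: "\<exists>V. finite_ext V \<and> (\<forall>n. \<forall>f\<in>F n. defect_coeff n 0 f \<in> V)"
proof -
  define I where "I = (\<lambda>n. if n = 0 then {0} else F n)"
  obtain N where N: "\<And>n. I n \<subseteq> generated_upto (below F n) I N n"
    using noeth graded_submodule_positive unfolding gr_noetherian_def I_def by blast
  obtain B where B: "\<And>n. finite (B n)" "\<And>n. F n = kR.span (B n)"
    using F_basis by metis
  obtain V0 where "finite_ext V0" using finite_ext_exists by blast
  then obtain V where V: "finite_ext V" "(\<Union>j\<le>N. defect_coeff j 0 ` B j) \<subseteq> V"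
    using finite_ext_adjoin[of "\<Union>j\<le>N. defect_coeff j 0 ` B j" V0] B(1) by auto
  have sub: "kR.subspace {f. defect_coeff n 0 f \<in> V}" for n
    by (intro defect_coeff_subspace finite_ext_subspace V)
  have "defect_coeff n 0 f \<in> V" if "f \<in> F n" for n f
    using that
  proof (induction n arbitrary: f rule: less_induct)
    case (less n)
    have "F n \<subseteq> {f. defect_coeff n 0 f \<in> V}"
    proof (cases "n \<le> N")
      case True
      then have "B n \<subseteq> {f. defect_coeff n 0 f \<in> V}" using V(2) by auto
      then show ?thesis unfolding B(2)[of n] using sub by (rule kR.span_minimal)
    next
      case False
      then obtain n' where n': "n = Suc n'" by (cases n) auto
      have "F n \<subseteq> generated_upto (below F n) I N n" using N[of n] by (simp add: I_def n')
      also have "\<dots> \<subseteq> {f. defect_coeff n 0 f \<in> V}"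
      proof (rule generated_upto_minimal[OF sub])
        have "defect_coeff n 0 f = 0" if "f \<in> F n'" for f
        proof (rule defect_coeff_lower)
          show "f \<in> defect_ge n (Suc 0)" using slope[OF that] q_pos by (simp add: defect_ge_def n')
        qed
        then show "below F n \<subseteq> {f. defect_coeff n 0 f \<in> V}"
          using kK.subspace_0[OF finite_ext_subspace[OF V(1)]] by (auto simp: below_def n')
        fix j g r assume j: "j \<le> N" "j \<le> n" "g \<in> I j" "r \<in> F (n - j)"
        show "g \<star> r \<in> {f. defect_coeff n 0 f \<in> V}"
        proof (cases "j = 0")
          case True
          then show ?thesis using j kK.subspace_0[OF finite_ext_subspace[OF V(1)]] by (simp add: I_def dmult_0 defect_coeff_0)
        next
          case j0: False
          then have g: "g \<in> F j" using j by (simp add: I_def)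
          have "defect_coeff (j + (n - j)) 0 (g \<star> r) = defect_coeff j 0 g * defect_coeff (n - j) 0 r"
            by (rule defect_ge_mult(2)[OF F_defect_ge[OF g] F_defect_ge[OF j(4)]])
          moreover have "defect_coeff j 0 g \<in> V" "defect_coeff (n - j) 0 r \<in> V"
            using less.IH[of j g] less.IH[of "n - j" r] j g j0 False by auto
          ultimately show ?thesis using finite_ext_mult[OF V(1)] j(2) by simp
        qed
      qed
      finally show ?thesis .
    qed
    then show ?case using less.prems by auto
  qed
  then show ?thesis using V(1) by blast
qed

text \<open>
  By finite generation, the coefficients at defect \<open>c\<close> of all elements of \<open>I\<close> come from finitely many coefficients,
  those of generators of \<open>I\<close>, and from the coefficients of the ring at defect \<open>0\<close>.
\<close>

lemma has_defect_coeff_extension: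
  assumes H: "gr_noetherian H" and I: "graded_submodule H I"
    and HP: "\<And>n. below H n \<subseteq> KF_below n" and IJ: "\<And>n. I n \<subseteq> KF_defect_ge n c"
    and fin: "\<And>n. \<exists>S. finite S \<and> I n \<subseteq> kR.span S"
    and V: "finite_ext V" "\<And>n f. f \<in> F n \<Longrightarrow> defect_coeff n 0 f \<in> V"
  shows "\<exists>V'. finite_ext V' \<and> V \<subseteq> V' \<and> (\<forall>n. \<forall>f\<in>I n. \<exists>a\<in>V'. has_defect_coeff n c f a)"
proof -
  obtain N where N: "\<And>n. I n \<subseteq> generated_upto (below H n) I N n"
    using H I unfolding gr_noetherian_def by blast
  have I_sub: "kR.subspace (I n)" for n using I by (simp add: graded_submodule_def)
  have "\<exists>B. finite B \<and> B \<subseteq> I n \<and> I n = kR.span B" for n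
    using fin[of n] finite_basis[OF I_sub] by blast
  then obtain B where B: "\<And>n. finite (B n)" "\<And>n. B n \<subseteq> I n" "\<And>n. I n = kR.span (B n)" by metis
  define t where "t n b = (SOME a. has_defect_coeff n c b a)" for n b
  have t: "has_defect_coeff n c b (t n b)" if "b \<in> B n" for n b
  proof -
    have "\<exists>a. has_defect_coeff n c b a" using that B(2) IJ KF_defect_ge_iff by blast
    then show ?thesis unfolding t_def by (rule someI_ex)
  qed
  obtain V' where V': "finite_ext V'" "V \<subseteq> V'" "(\<Union>j\<le>N. t j ` B j) \<subseteq> V'"
    using finite_ext_adjoin[of "\<Union>j\<le>N. t j ` B j" V] V(1) B(1) by auto
  note V'_sub = finite_ext_subspace[OF V'(1)]
  have small: "\<exists>a\<in>V'. has_defect_coeff j c g a" if "j \<le> N" "g \<in> I j" for j g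
  proof (rule has_defect_coeff_span[OF V'_sub])
    show "g \<in> kR.span (B j)" using that B(3) by simp
    show "\<exists>a\<in>V'. has_defect_coeff j c b a" if "b \<in> B j" for b
      using t[OF that] V'(3) that \<open>j \<le> N\<close> by blast
  qed
  have "\<exists>a\<in>V'. has_defect_coeff n c f a" if "f \<in> I n" for n f
  proof (rule has_defect_coeff_span[OF V'_sub])
    show "f \<in> kR.span (below H n \<union> {g \<star> r |g r j. j \<le> N \<and> j \<le> n \<and> g \<in> I j \<and> r \<in> F (n - j)})"
      using that N[of n] by (auto simp: generated_upto_def)
    fix b assume "b \<in> below H n \<union> {g \<star> r |g r j. j \<le> N \<and> j \<le> n \<and> g \<in> I j \<and> r \<in> F (n - j)}"
    then consider "b \<in> below H n" | g r j where "b = g \<star> r" "j \<le> N" "j \<le> n" "g \<in> I j" "r \<in> F (n - j)" by blast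
    then show "\<exists>a\<in>V'. has_defect_coeff n c b a"
    proof cases
      case 1 then show ?thesis using HP has_defect_coeff_KF_below kK.subspace_0[OF V'_sub] by blast
    next
      case 2
      obtain a where a: "a \<in> V'" "has_defect_coeff j c g a" using small 2 by blast
      have "has_defect_coeff n c b (a * defect_coeff (n - j) 0 r)" using has_defect_coeff_mult[OF a(2) 2(5)] 2(1,3) by simp
      moreover have "a * defect_coeff (n - j) 0 r \<in> V'"
        using V(2)[OF 2(5)] V'(2) a(1) by (intro finite_ext_mult[OF V'(1)]) auto
      ultimately show ?thesis by blast
    qed
  qed
  then show ?thesis using V' by blast
qed

lemma graded_submodule_KF_defect_ge: "finite_ext V \<Longrightarrow> graded_submodule (\<lambda>n. coeff_span V (F n)) (\<lambda>n. coeff_span V (F n) \<inter> KF_defect_ge n c)"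
proof -
  have *: "below (\<lambda>n. coeff_span V (F n)) n \<subseteq> KF_defect_ge n c" for n
    using coeff_span_mono[of V UNIV "below F n" "below F n"] KF_below_defect_ge by (auto simp: below_coeff_span KF_below_def)
  show ?thesis unfolding graded_submodule_def
    using * below_subset[OF filtered_module_coeff_span, of V] KF_defect_ge_mult filtered_module_coeff_span[of V]
    by (auto intro!: kR.subspace_inter coeff_span_subspace KF_defect_ge_subspace simp: filtered_module_def)
qed

text \<open>
  The spaces \<open>V' F\<^sub>n \<inter> (K F\<^bsub>n-1\<^esub> + defect_ge n c)\<close>, for all \<open>n\<close> at once, are defined over a finite
  extension of \<open>k\<close> that depends only on \<open>c\<close>.
\<close>

lemma KF_defect_ge_descent:
  "\<exists>V. finite_ext V \<and> (\<forall>V' n. finite_ext V' \<longrightarrow> V \<subseteq> V' \<longrightarrow> coeff_span V' (F n) \<inter> KF_defect_ge n c \<subseteq> coeff_span V' (coeff_span V (F n) \<inter> KF_defect_ge n c))"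
proof (induction c)
  case 0
  obtain V where V: "finite_ext V" using finite_ext_exists by blast
  have "F n \<subseteq> coeff_span V (F n) \<inter> KF_defect_ge n 0" for n
  proof
    fix f assume f: "f \<in> F n"
    have "1 \<in> V" using V by (simp add: finite_ext_def)
    then have "f \<in> coeff_span V (F n)" using coeff_span_base[of 1 V f] f by simp
    moreover have "f \<in> KF_defect_ge n 0" unfolding KF_defect_ge_def using F_defect_ge[OF f] kR.subspace_0[OF KF_below_subspace] by force
    ultimately show "f \<in> coeff_span V (F n) \<inter> KF_defect_ge n 0" by blast
  qed
  then show ?case using V coeff_span_mono by (metis order_refl le_infI1)
next
  case (Suc c)
  then obtain V where V: "finite_ext V"
    and VJ: "\<And>V' n. finite_ext V' \<Longrightarrow> V \<subseteq> V' \<Longrightarrow> coeff_span V' (F n) \<inter> KF_defect_ge n c \<subseteq> coeff_span V' (coeff_span V (F n) \<inter> KF_defect_ge n c)" by blast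
  obtain V1 where V1: "finite_ext V1" "\<And>n f. f \<in> F n \<Longrightarrow> defect_coeff n 0 f \<in> V1" using defect_coeff_extension by blast
  obtain S where S: "finite S" "V1 = kK.span S" using V1 by (auto simp: finite_ext_def)
  obtain V2 where V2: "finite_ext V2" "V \<subseteq> V2" "S \<subseteq> V2" using finite_ext_adjoin[OF S(1) V] by blast
  have "V1 \<subseteq> V2" unfolding S(2) using V2(3) finite_ext_subspace[OF V2(1)] by (rule kK.span_minimal)
  then have V2_top: "defect_coeff n 0 f \<in> V2" if "f \<in> F n" for n f using V1(2)[OF that] by blast
  define I where "I = (\<lambda>n. coeff_span V (F n) \<inter> KF_defect_ge n c)"
  have "\<exists>V'. finite_ext V' \<and> V2 \<subseteq> V' \<and> (\<forall>n. \<forall>f\<in>I n. \<exists>a\<in>V'. has_defect_coeff n c f a)"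
  proof (rule has_defect_coeff_extension)
    show "gr_noetherian (\<lambda>n. coeff_span V (F n))" using noeth V by (rule gr_noetherian_coeff_span)
    show "graded_submodule (\<lambda>n. coeff_span V (F n)) I" unfolding I_def using V by (rule graded_submodule_KF_defect_ge)
    show "below (\<lambda>n. coeff_span V (F n)) n \<subseteq> KF_below n" for n unfolding below_coeff_span KF_below_def by (intro coeff_span_mono) auto
    show "I n \<subseteq> KF_defect_ge n c" for n by (auto simp: I_def)
    show "\<exists>S. finite S \<and> I n \<subseteq> kR.span S" for n using finite_span_coeff_span[OF V, of n] unfolding I_def by blast
  qed (use V2 V2_top in auto)
  then obtain V3 where V3: "finite_ext V3" "V2 \<subseteq> V3"
    and t: "\<And>n f. f \<in> I n \<Longrightarrow> \<exists>a\<in>V3. has_defect_coeff n c f a" by blast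
  have "coeff_span V' (F n) \<inter> KF_defect_ge n (Suc c) \<subseteq> coeff_span V' (coeff_span V3 (F n) \<inter> KF_defect_ge n (Suc c))"
    if V': "finite_ext V'" "V3 \<subseteq> V'" for V' n
  proof
    fix u assume u: "u \<in> coeff_span V' (F n) \<inter> KF_defect_ge n (Suc c)"
    let ?W = "coeff_span V3 (F n) \<inter> KF_defect_ge n (Suc c)"
    have VV3: "coeff_span V (F n) \<subseteq> coeff_span V3 (F n)" using V2(2) V3(2) by (intro coeff_span_mono) auto
    have "u \<in> coeff_span V' (I n)" unfolding I_def
      using VJ[OF V'(1), of n] u KF_defect_ge_Suc V2(2) V3(2) V'(2) by blast
    show "u \<in> coeff_span V' ?W"
    proof (cases "I n \<subseteq> KF_defect_ge n (Suc c)")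
      case True
      then have "I n \<subseteq> ?W" using VV3 by (auto simp: I_def)
      then show ?thesis using coeff_span_mono[of V' V' "I n" ?W] \<open>u \<in> coeff_span V' (I n)\<close> by blast
    next
      case False
      \<comment> \<open>The pivot \<open>z\<close> has a nonzero coefficient \<open>b\<close> at defect \<open>c\<close>, and all quotients \<open>a / b\<close> lie in \<open>V3\<close>.\<close>
      then obtain z where z: "z \<in> I n" "z \<notin> KF_defect_ge n (Suc c)" by blast
      obtain b where b: "b \<in> V3" "has_defect_coeff n c z b" using t[OF z(1)] by blast
      have "b \<noteq> 0" using b(2) z(2) has_defect_coeff_0 by blast
      note V'_sub = finite_ext_subspace[OF V'(1)]
      have "coeff_span V' (I n) \<subseteq> {f. \<exists>v\<in>V'. f - smult v z \<in> coeff_span V' ?W}"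
      proof (rule coeff_span_minimal)
        show "kR.subspace {f. \<exists>v\<in>V'. f - smult v z \<in> coeff_span V' ?W}"
        proof (rule kR.subspaceI)
          show "0 \<in> {f. \<exists>v\<in>V'. f - smult v z \<in> coeff_span V' ?W}"
            using kK.subspace_0[OF V'_sub] kR.subspace_0[OF coeff_span_subspace] by (auto intro!: bexI[of _ 0])
        next
          fix x y assume "x \<in> {f. \<exists>v\<in>V'. f - smult v z \<in> coeff_span V' ?W}" "y \<in> {f. \<exists>v\<in>V'. f - smult v z \<in> coeff_span V' ?W}"
          then obtain v v' where v: "v \<in> V'" "x - smult v z \<in> coeff_span V' ?W" "v' \<in> V'" "y - smult v' z \<in> coeff_span V' ?W" by blast
          have e: "(x - smult v z) + (y - smult v' z) = x + y - smult (v + v') z" by (simp add: smult_add_left)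
          have "x + y - smult (v + v') z \<in> coeff_span V' ?W"
            using kR.subspace_add[OF coeff_span_subspace v(2,4)] unfolding e .
          then show "x + y \<in> {f. \<exists>v\<in>V'. f - smult v z \<in> coeff_span V' ?W}"
            using kK.subspace_add[OF V'_sub v(1,3)] by blast
        next
          fix e x assume "x \<in> {f. \<exists>v\<in>V'. f - smult v z \<in> coeff_span V' ?W}"
          then obtain v where v: "v \<in> V'" "x - smult v z \<in> coeff_span V' ?W" by blast
          have e: "poly_scale e (x - smult v z) = poly_scale e x - smult (field_scale e v) z"
            by (simp add: poly_scale_def field_scale_def smult_diff_right)
          have "poly_scale e x - smult (field_scale e v) z \<in> coeff_span V' ?W"
            using kR.subspace_scale[OF coeff_span_subspace v(2), of e] unfolding e .
          then show "poly_scale e x \<in> {f. \<exists>v\<in>V'. f - smult v z \<in> coeff_span V' ?W}"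
            using kK.subspace_scale[OF V'_sub v(1)] by blast
        qed
      next
        fix v f assume v: "v \<in> V'" and f: "f \<in> I n"
        obtain a where a: "a \<in> V3" "has_defect_coeff n c f a" using t[OF f] by blast
        define e where "e = a * inverse b"
        have e: "e \<in> V3" unfolding e_def
          using a b by (intro finite_ext_mult[OF V3(1)] finite_ext_inverse[OF V3(1)])
        have "has_defect_coeff n c (f + smult (- e) z) (a + (- e) * b)"
          by (intro has_defect_coeff_add a has_defect_coeff_smult b)
        moreover have "a + (- e) * b = 0" using \<open>b \<noteq> 0\<close> by (simp add: e_def)
        ultimately have "f - smult e z \<in> KF_defect_ge n (Suc c)" using has_defect_coeff_0[of n c "f - smult e z"] by simp
        moreover have "smult e z \<in> coeff_span V3 (F n)"
          using z(1) VV3 e by (intro coeff_span_smult finite_ext_mult[OF V3(1)]) (auto simp: I_def)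
        then have "f - smult e z \<in> coeff_span V3 (F n)"
          using f VV3 by (intro kR.subspace_diff[OF coeff_span_subspace]) (auto simp: I_def)
        ultimately have "smult v (f - smult e z) \<in> coeff_span V' ?W" using v by (intro coeff_span_base) auto
        then have "smult v f - smult (v * e) z \<in> coeff_span V' ?W" by (simp add: smult_diff_right)
        then show "smult v f \<in> {f. \<exists>v\<in>V'. f - smult v z \<in> coeff_span V' ?W}"
          using finite_ext_mult[OF V'(1) v] e V'(2) by blast
      qed
      then obtain v where v: "v \<in> V'" "u - smult v z \<in> coeff_span V' ?W" using \<open>u \<in> coeff_span V' (I n)\<close> by blast
      have "coeff_span V' ?W \<subseteq> KF_defect_ge n (Suc c)" by (rule coeff_span_minimal[OF KF_defect_ge_subspace]) (auto intro: KF_defect_ge_smult)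
      \<comment> \<open>The remaining multiple of the pivot must vanish, since \<open>z\<close> itself is not in \<open>KF_defect_ge n (Suc c)\<close>.\<close>
      then have "u - (u - smult v z) \<in> KF_defect_ge n (Suc c)"
        using u v(2) kR.subspace_diff[OF KF_defect_ge_subspace, of u n "Suc c" "u - smult v z"] by blast
      then have "smult v z \<in> KF_defect_ge n (Suc c)" by simp
      then have "smult (inverse v) (smult v z) \<in> KF_defect_ge n (Suc c)" by (rule KF_defect_ge_smult)
      then have "v = 0" using z(2) by (cases "v = 0") simp_all
      then show ?thesis using v(2) by simp
    qed
  qed
  then show ?case using V3(1) by blast
qed

lemma coeff_span_finite_set:
  assumes "finite B" "B \<subseteq> coeff_span UNIV U" shows "\<exists>Z. finite Z \<and> B \<subseteq> coeff_span Z U"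
  using assms
proof (induction B)
  case (insert b B)
  then obtain Z Z' where Z: "finite Z" "B \<subseteq> coeff_span Z U" "finite Z'" "b \<in> coeff_span Z' U"
    using coeff_span_finite[of b U] by auto
  have "coeff_span Z U \<subseteq> coeff_span (Z \<union> Z') U" "coeff_span Z' U \<subseteq> coeff_span (Z \<union> Z') U" by (intro coeff_span_mono; simp)+
  then show ?case using Z by (intro exI[of _ "Z \<union> Z'"]) auto
qed auto

text \<open>
  The spaces \<open>V F\<^sub>n \<inter> K F\<^bsub>n-1\<^esub>\<close> form a finitely generated module; its finitely many generators
  in \<open>K F\<^bsub>j-1\<^esub>\<close> lie in \<open>V3 F\<^bsub>j-1\<^esub>\<close> for some finite extension \<open>V3\<close> of \<open>V\<close>.
\<close>

lemma KF_below_descent: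
  "\<exists>V. finite_ext V \<and> (\<forall>n. coeff_span V (F n) \<inter> KF_below n \<subseteq> coeff_span V (below F n))"
proof -
  obtain C where C: "\<And>n. defect_ge n (Suc C) \<subseteq> KF_below n" using defect_ge_large by blast
  have JP: "KF_defect_ge n (Suc C) = KF_below n" for n
  proof
    show "KF_defect_ge n (Suc C) \<subseteq> KF_below n"
      using C[of n] by (auto simp: KF_defect_ge_def intro!: kR.subspace_add[OF KF_below_subspace])
    show "KF_below n \<subseteq> KF_defect_ge n (Suc C)" using KF_below_defect_ge by blast
  qed
  obtain V where V: "finite_ext V"
    and VP: "\<And>V' n. finite_ext V' \<Longrightarrow> V \<subseteq> V' \<Longrightarrow> coeff_span V' (F n) \<inter> KF_below n \<subseteq> coeff_span V' (coeff_span V (F n) \<inter> KF_below n)"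
    using KF_defect_ge_descent[of "Suc C"] unfolding JP by blast
  define I where "I = (\<lambda>n. coeff_span V (F n) \<inter> KF_below n)"
  have "graded_submodule (\<lambda>n. coeff_span V (F n)) I"
    using graded_submodule_KF_defect_ge[OF V, of "Suc C"] by (simp add: I_def JP)
  then obtain N where N: "\<And>n. I n \<subseteq> generated_upto (below (\<lambda>n. coeff_span V (F n)) n) I N n"
    using gr_noetherian_coeff_span[OF noeth V] unfolding gr_noetherian_def by blast
  have "\<exists>B. finite B \<and> B \<subseteq> I n \<and> I n = kR.span B" for n
  proof -
    obtain S where "finite S" "coeff_span V (F n) \<subseteq> kR.span S" using finite_span_coeff_span[OF V] by blast
    then show ?thesis unfolding I_def
      by (intro finite_basis[of _ S] kR.subspace_inter coeff_span_subspace KF_below_subspace) auto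
  qed
  then obtain B where B: "\<And>n. finite (B n)" "\<And>n. B n \<subseteq> I n" "\<And>n. I n = kR.span (B n)" by metis
  have "\<exists>Z. finite Z \<and> B n \<subseteq> coeff_span Z (below F n)" for n
    using B(1,2)[of n] by (intro coeff_span_finite_set) (auto simp: I_def KF_below_def)
  then obtain Z where Z: "\<And>n. finite (Z n)" "\<And>n. B n \<subseteq> coeff_span (Z n) (below F n)" by metis
  have "finite (\<Union>j\<le>N. Z j)" using Z(1) by auto
  then obtain V3 where V3: "finite_ext V3" "V \<subseteq> V3" "(\<Union>j\<le>N. Z j) \<subseteq> V3"
    using finite_ext_adjoin[OF _ V] by blast
  have small: "I j \<subseteq> coeff_span V3 (below F j)" if "j \<le> N" for j
    unfolding B(3)[of j]
  proof (rule kR.span_minimal[OF _ coeff_span_subspace])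
    have "coeff_span (Z j) (below F j) \<subseteq> coeff_span V3 (below F j)" using V3(3) that by (intro coeff_span_mono) auto
    then show "B j \<subseteq> coeff_span V3 (below F j)" using Z(2) by blast
  qed
  have I_V3: "I n \<subseteq> coeff_span V3 (below F n)" for n
  proof -
    note N[of n]
    also have "generated_upto (below (\<lambda>n. coeff_span V (F n)) n) I N n \<subseteq> coeff_span V3 (below F n)"
    proof (rule generated_upto_minimal[OF coeff_span_subspace])
      show "below (\<lambda>n. coeff_span V (F n)) n \<subseteq> coeff_span V3 (below F n)"
        unfolding below_coeff_span using V3(2) by (intro coeff_span_mono) auto
      fix j g r assume j: "j \<le> N" "j \<le> n" "g \<in> I j" "r \<in> F (n - j)"
      have "g \<in> coeff_span V3 (below F j)" using small j by blast
      then show "g \<star> r \<in> coeff_span V3 (below F n)"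
        using below_mult[OF filtered_module_F _ j(4), of _ j] j(2) by (elim coeff_span_dmult) simp
    qed
    finally show ?thesis .
  qed
  have "coeff_span V3 (F n) \<inter> KF_below n \<subseteq> coeff_span V3 (below F n)" for n
  proof -
    have "coeff_span V3 (F n) \<inter> KF_below n \<subseteq> coeff_span V3 (I n)" unfolding I_def by (rule VP[OF V3(1,2)])
    also have "\<dots> \<subseteq> coeff_span V3 (below F n)"
      using I_V3[of n] by (intro coeff_span_minimal coeff_span_subspace coeff_span_smult finite_ext_mult[OF V3(1)]) auto
    finally show ?thesis .
  qed
  then show ?thesis using V3(1) by blast
qed

lemma sloped_finite_over_ground: "\<exists>S. finite S \<and> kK.span S = UNIV"
proof -
  obtain V where V: "finite_ext V" and VP: "\<And>n. coeff_span V (F n) \<inter> KF_below n \<subseteq> coeff_span V (below F n)"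
    using KF_below_descent by blast
  have descend: "[:b:] \<in> coeff_span V (F n) \<Longrightarrow> [:b:] \<in> coeff_span V (F 0)" for b n
  proof (induction n)
    case (Suc n)
    have "smult b 1 \<in> KF_below (Suc n)" using F_KF_below[OF F_one] by (intro KF_below_smult) simp
    then have "[:b:] \<in> coeff_span V (below F (Suc n))" using VP[of "Suc n"] Suc.prems by auto
    then show ?case using Suc.IH by (simp add: below_def)
  qed
  have const: "[:b:] \<in> coeff_span V (F 0)" for b
  proof -
    obtain n where "[:b:] \<in> F n" using F_exhaustive by blast
    moreover have "1 \<in> V" using V by (simp add: finite_ext_def)
    ultimately have "[:b:] \<in> coeff_span V (F n)" using coeff_span_base[of 1 V "[:b:]" "F n"] by simp
    then show ?thesis by (rule descend)
  qed
  obtain S where S: "finite S" "coeff_span V (F 0) \<subseteq> kR.span S" using finite_span_coeff_span[OF V] by blast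
  let ?S = "(\<lambda>f. coeff f 0) ` S"
  have "kR.span S \<subseteq> {f. coeff f 0 \<in> kK.span ?S}"
  proof (intro kR.span_minimal kR.subspaceI)
    fix c and f :: "'a poly" assume "f \<in> {f. coeff f 0 \<in> kK.span ?S}"
    then show "poly_scale c f \<in> {f. coeff f 0 \<in> kK.span ?S}"
      using kK.span_scale[of "coeff f 0" ?S c] by (simp add: poly_scale_def field_scale_def)
  qed (auto intro: kK.span_base kK.span_add kK.span_zero)
  then have "b \<in> kK.span ?S" for b using const[of b] S(2) by force
  then show ?thesis using S(1) by (intro exI[of _ ?S]) auto
qed

end

lemma (in diff_poly_filtration) finite_over_ground:
  assumes "gr_noetherian F" shows "\<exists>S. finite S \<and> kK.span S = UNIV"
proof -
  obtain m q w where "m > 0" "q > 0" "w \<in> F m" "degree w = q" "\<And>n f. f \<in> F n \<Longrightarrow> m * degree f \<le> q * n"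
    using slope_exists[OF assms] by blast
  then interpret sloped_filtration d p F m q w by unfold_locales (use assms in auto)
  show ?thesis by (rule sloped_finite_over_ground)
qed

section \<open>Right ideals of the associated graded ring\<close>

context frobenius_derivation
begin

text \<open>
  The differential polynomial ring, whose carrier is the whole type \<open>'a poly\<close>.
\<close>

abbreviation "R \<equiv> diff_poly_ring d"

lemma R_ops [simp]: "carrier R = UNIV" "f \<otimes>\<^bsub>R\<^esub> g = f \<star> g" "f \<oplus>\<^bsub>R\<^esub> g = f + g" "\<zero>\<^bsub>R\<^esub> = 0" "\<one>\<^bsub>R\<^esub> = 1"
  by (simp_all add: diff_poly_ring_def)

lemma const_mult: "[:a:] \<star> f = smult a f"
  using dmult_smult[of a 1 f] by (simp add: dmult_one)

sublocale R: ring R by (rule ring_diff_poly_ring[OF deriv])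

lemma R_finsum: "finite A \<Longrightarrow> (\<Oplus>\<^bsub>R\<^esub>i\<in>A. f i) = sum f A"
  by (induction A rule: finite_induct) (auto simp: R.finsum_insert)

lemma finite_span_of_dimension: "R.dimension n (range (\<lambda>a. [:a ^ p:])) E \<Longrightarrow> \<exists>S. finite S \<and> E \<subseteq> kR.span S"
proof (induction n "range (\<lambda>a::'a. [:a ^ p:])" E rule: R.dimension.induct)
  case zero_dim
  then show ?case using kR.span_zero by (intro exI[of _ "{}"]) auto
next
  case (Suc_dim v E n)
  then obtain S where S: "finite S" "E \<subseteq> kR.span S" by blast
  have "R.line_extension (range (\<lambda>a. [:a ^ p:])) v E \<subseteq> kR.span (insert v S)"
  proof
    fix u assume "u \<in> R.line_extension (range (\<lambda>a. [:a ^ p:])) v E"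
    then obtain a e where u: "u = poly_scale a v + e" "e \<in> E"
      by (auto simp: R.line_extension_mem_iff const_mult poly_scale_def)
    have "poly_scale a v \<in> kR.span (insert v S)" by (intro kR.span_scale kR.span_base) simp
    moreover have "e \<in> kR.span (insert v S)" using u(2) S(2) kR.span_mono[of S "insert v S"] by blast
    ultimately show "u \<in> kR.span (insert v S)" unfolding u(1) by (rule kR.span_add)
  qed
  then show ?case using S(1) by (intro exI[of _ "insert v S"]) auto
qed

lemma diff_poly_filtration_of_fd_filtration:
  assumes F: "fd_filtration R (range (\<lambda>a. [:a ^ p:])) F"
  shows "diff_poly_filtration d p F"
proof
  have sub: "subalgebra (range (\<lambda>a. [:a ^ p:])) (F n) R" for n using F by (simp add: fd_filtration_def)
  show "kR.subspace (F n)" for n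
  proof (rule kR.subspaceI)
    interpret S: subalgebra "range (\<lambda>a. [:a ^ p:])" "F n" R by (rule sub)
    show "0 \<in> F n" using S.one_closed by simp
    show "x + y \<in> F n" if "x \<in> F n" "y \<in> F n" for x y using S.m_closed[OF that] by simp
    show "poly_scale c x \<in> F n" if "x \<in> F n" for c x
      using S.smult_closed[of "[:c ^ p:]" x] that by (simp add: const_mult poly_scale_def)
  qed
  have "range (\<lambda>a. [:a ^ p:]) \<subseteq> F 0" using F by (simp only: fd_filtration_def)
  then have "[:1 ^ p:] \<in> F 0" by blast
  then show "1 \<in> F 0" by (simp add: one_pCons)
  have "(\<Union>i. F i) = UNIV" using F by (simp add: fd_filtration_def)
  then show "\<exists>n. f \<in> F n" for f by blast
  have "R.finite_dimension (range (\<lambda>a. [:a ^ p:])) (F n)" for n using F by (simp only: fd_filtration_def)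
  then show "\<exists>S. finite S \<and> F n \<subseteq> kR.span S" for n
    unfolding R.finite_dimension_def using finite_span_of_dimension by blast
  show "F n \<subseteq> F (Suc n)" for n using F by (simp only: fd_filtration_def)
  show "f \<star> g \<in> F (i + j)" if "f \<in> F i" "g \<in> F j" for f g i j
    using F that unfolding fd_filtration_def R_ops by blast
qed

end

context diff_poly_filtration
begin

abbreviation "A \<equiv> assoc_graded R F"

text \<open>
  The class of \<open>a\<close> modulo \<open>F (n - 1)\<close>.
\<close>

definition symbol :: "nat \<Rightarrow> 'a poly \<Rightarrow> 'a poly set" where
  "symbol n a = (\<lambda>h. h + a) ` below F n"

lemma symbol_eq_rcoset: "prev_fil R F n +>\<^bsub>R\<^esub> a = symbol n a"
  by (cases n) (auto simp: prev_fil_def symbol_def below_def a_r_coset_def r_coset_def)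

lemma prev_fil_eq: "prev_fil R F n = symbol n 0"
  by (cases n) (auto simp: prev_fil_def symbol_def below_def)

lemma below_F_subspace: "kR.subspace (below F n)" by (rule below_subspace[OF filtered_module_F])

lemma symbol_eq_iff: "symbol n a = symbol n b \<longleftrightarrow> a - b \<in> below F n"
proof
  assume "symbol n a = symbol n b"
  moreover have "a \<in> symbol n a" unfolding symbol_def using kR.subspace_0[OF below_F_subspace] by force
  ultimately obtain h where "h \<in> below F n" "a = h + b" by (auto simp: symbol_def)
  then show "a - b \<in> below F n" by simp
next
  have sub: "symbol n a \<subseteq> symbol n b" if "a - b \<in> below F n" for a b
  proof
    fix x assume "x \<in> symbol n a"
    then obtain h where h: "h \<in> below F n" "x = h + a" by (auto simp: symbol_def)
    then have "h + (a - b) \<in> below F n" using that by (intro kR.subspace_add[OF below_F_subspace])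
    moreover have "x = (h + (a - b)) + b" using h by simp
    ultimately show "x \<in> symbol n b" unfolding symbol_def by blast
  qed
  assume ab: "a - b \<in> below F n"
  then have "b - a \<in> below F n" using kR.subspace_neg[OF below_F_subspace ab] by simp
  then show "symbol n a = symbol n b" using sub ab by blast
qed

lemma symbol_add: "symbol n a <+>\<^bsub>R\<^esub> symbol n b = symbol n (a + b)"
proof -
  have "(h + a) + (h' + b) \<in> symbol n (a + b)" if "h \<in> below F n" "h' \<in> below F n" for h h'
  proof -
    have "h + h' \<in> below F n" using that by (intro kR.subspace_add[OF below_F_subspace])
    moreover have "(h + a) + (h' + b) = (h + h') + (a + b)" by simp
    ultimately show ?thesis unfolding symbol_def by blast
  qed
  moreover have "\<exists>x\<in>symbol n a. \<exists>y\<in>symbol n b. h + (a + b) = x + y" if "h \<in> below F n" for h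
    using that kR.subspace_0[OF below_F_subspace]
    by (intro bexI[of _ "h + a"] bexI[of _ "0 + b"]) (auto simp: symbol_def)
  ultimately show ?thesis unfolding set_add_def' by (auto simp: symbol_def)
qed

text \<open>
  The element of the graded ring with components represented by \<open>a\<close>.  Each element arises from a family of
  representatives that are \<open>0\<close> in all but finitely many degrees, even though the zero classes have other representatives.
\<close>

definition graded_elem :: "(nat \<Rightarrow> 'a poly) \<Rightarrow> nat \<Rightarrow> 'a poly set" where
  "graded_elem a = (\<lambda>n. symbol n (a n))"

text \<open>
  The finitely supported families of representatives taken from \<open>E\<close>.
\<close>

definition rep_families :: "(nat \<Rightarrow> 'a poly set) \<Rightarrow> (nat \<Rightarrow> 'a poly) set" where
  "rep_families E = {a. (\<forall>n. a n \<in> E n) \<and> finite {n. a n \<noteq> 0}}"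

lemma carrier_assoc_graded:
  "carrier A = {u. (\<forall>n. \<exists>a\<in>F n. u n = symbol n a) \<and> finite {n. u n \<noteq> symbol n 0}}"
  unfolding assoc_graded_def gr_component_def symbol_eq_rcoset partial_object.simps image_iff
  unfolding prev_fil_eq ..

lemma graded_elem_carrier: "carrier A = graded_elem ` rep_families F"
proof
  show "graded_elem ` rep_families F \<subseteq> carrier A"
  proof
    fix u assume "u \<in> graded_elem ` rep_families F"
    then obtain a where a: "\<And>n. a n \<in> F n" "finite {n. a n \<noteq> 0}" "u = graded_elem a" by (auto simp: rep_families_def)
    have "{n. u n \<noteq> symbol n 0} \<subseteq> {n. a n \<noteq> 0}" by (auto simp: a(3) graded_elem_def)
    then have "finite {n. u n \<noteq> symbol n 0}" using a(2) by (rule finite_subset)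
    moreover have "\<exists>a\<in>F n. u n = symbol n a" for n using a(1) by (auto simp: a(3) graded_elem_def)
    ultimately show "u \<in> carrier A" unfolding carrier_assoc_graded by blast
  qed
  show "carrier A \<subseteq> graded_elem ` rep_families F"
  proof
    fix u assume u: "u \<in> carrier A"
    have "\<exists>a\<in>F n. u n = symbol n a \<and> (u n = symbol n 0 \<longrightarrow> a = 0)" for n
      using u kR.subspace_0[OF F_subspace] unfolding carrier_assoc_graded by (cases "u n = symbol n 0") blast+
    then obtain a where a: "\<And>n. a n \<in> F n" "\<And>n. u n = symbol n (a n)" "\<And>n. u n = symbol n 0 \<longrightarrow> a n = 0"
      by metis
    have "{n. a n \<noteq> 0} \<subseteq> {n. u n \<noteq> symbol n 0}" using a(3) by blast
    moreover have "finite {n. u n \<noteq> symbol n 0}" using u unfolding carrier_assoc_graded by blast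
    ultimately have "finite {n. a n \<noteq> 0}" by (rule finite_subset)
    then have "a \<in> rep_families F" using a(1) by (simp add: rep_families_def)
    moreover have "u = graded_elem a" using a(2) by (auto simp: graded_elem_def)
    ultimately show "u \<in> graded_elem ` rep_families F" by blast
  qed
qed

lemma graded_elem_add: "graded_elem a \<oplus>\<^bsub>A\<^esub> graded_elem b = graded_elem (\<lambda>n. a n + b n)"
  by (simp add: assoc_graded_def graded_elem_def symbol_add)

lemma graded_elem_zero: "\<zero>\<^bsub>A\<^esub> = graded_elem (\<lambda>n. 0)"
  by (simp add: assoc_graded_def graded_elem_def prev_fil_eq fun_eq_iff)

lemma graded_elem_eq_iff: "graded_elem a = graded_elem b \<longleftrightarrow> (\<forall>n. a n - b n \<in> below F n)"
  by (auto simp: graded_elem_def fun_eq_iff symbol_eq_iff)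

lemma graded_elem_mult:
  assumes fil: "fd_filtration R k F" and "a \<in> rep_families F" "b \<in> rep_families F"
  shows "graded_elem a \<otimes>\<^bsub>A\<^esub> graded_elem b = graded_elem (\<lambda>n. \<Sum>i\<le>n. a i \<star> b (n - i))"
proof
  fix n
  have "(graded_elem a \<otimes>\<^bsub>A\<^esub> graded_elem b) n = prev_fil R F n +>\<^bsub>R\<^esub> (\<Oplus>\<^bsub>R\<^esub>i\<in>{..n}. a i \<otimes>\<^bsub>R\<^esub> b (n - i))"
    unfolding graded_elem_def symbol_eq_rcoset[symmetric]
    by (rule assoc_graded_mult_coset[OF R.ring_axioms _ fil]) (use assms(2,3) in \<open>auto simp: rep_families_def\<close>)
  then show "(graded_elem a \<otimes>\<^bsub>A\<^esub> graded_elem b) n = graded_elem (\<lambda>n. \<Sum>i\<le>n. a i \<star> b (n - i)) n"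
    by (simp add: symbol_eq_rcoset graded_elem_def R_finsum)
qed

lemma graded_elem_right_ideal:
  assumes fil: "fd_filtration R k F" and E: "\<And>n. kR.subspace (E n)" "\<And>n. E n \<subseteq> F n"
    and E_mult: "\<And>i j g r. g \<in> E i \<Longrightarrow> r \<in> F j \<Longrightarrow> g \<star> r \<in> E (i + j)"
  shows "right_ideal (graded_elem ` rep_families E) A"
  unfolding right_ideal_def additive_subgroup_def
proof (intro conjI ballI subgroup.intro)
  have fE: "rep_families E \<subseteq> rep_families F" using E(2) by (auto simp: rep_families_def)
  then show *: "graded_elem ` rep_families E \<subseteq> carrier (add_monoid A)" by (auto simp: graded_elem_carrier)
  have add: "(\<lambda>n. a n + b n) \<in> rep_families E'" if "a \<in> rep_families E'" "b \<in> rep_families E'" "\<And>n. kR.subspace (E' n)" for a b E'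
  proof -
    have "{n. a n + b n \<noteq> 0} \<subseteq> {n. a n \<noteq> 0} \<union> {n. b n \<noteq> 0}" by auto
    then show ?thesis using that kR.subspace_add unfolding rep_families_def by (auto intro: finite_subset)
  qed
  fix u assume "u \<in> graded_elem ` rep_families E"
  then obtain a where a: "u = graded_elem a" "a \<in> rep_families E" by blast
  {
    fix v assume "v \<in> graded_elem ` rep_families E"
    then obtain b where b: "v = graded_elem b" "b \<in> rep_families E" by blast
    have "u \<oplus>\<^bsub>A\<^esub> v = graded_elem (\<lambda>n. a n + b n)" by (simp add: a b graded_elem_add)
    then show "u \<otimes>\<^bsub>add_monoid A\<^esub> v \<in> graded_elem ` rep_families E" using add[OF a(2) b(2) E(1)] by simp
  }
  have neg: "(\<lambda>n. - a n) \<in> rep_families E"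
    using a(2) kR.subspace_neg[OF E(1)] by (auto simp: rep_families_def)
  have "inv\<^bsub>add_monoid A\<^esub> u = graded_elem (\<lambda>n. - a n)"
    unfolding m_inv_def
  proof (rule the_equality)
    show "graded_elem (\<lambda>n. - a n) \<in> carrier (add_monoid A) \<and> u \<otimes>\<^bsub>add_monoid A\<^esub> graded_elem (\<lambda>n. - a n) = \<one>\<^bsub>add_monoid A\<^esub> \<and>
        graded_elem (\<lambda>n. - a n) \<otimes>\<^bsub>add_monoid A\<^esub> u = \<one>\<^bsub>add_monoid A\<^esub>"
      using neg * by (auto simp: a graded_elem_add graded_elem_zero)
    fix y assume y: "y \<in> carrier (add_monoid A) \<and> u \<otimes>\<^bsub>add_monoid A\<^esub> y = \<one>\<^bsub>add_monoid A\<^esub> \<and> y \<otimes>\<^bsub>add_monoid A\<^esub> u = \<one>\<^bsub>add_monoid A\<^esub>"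
    then obtain b where b: "y = graded_elem b" by (auto simp: graded_elem_carrier)
    from y have "a n + b n \<in> below F n" for n by (simp add: a b graded_elem_add graded_elem_zero graded_elem_eq_iff)
    then show "y = graded_elem (\<lambda>n. - a n)" by (simp add: b graded_elem_eq_iff add.commute)
  qed
  then show "inv\<^bsub>add_monoid A\<^esub> u \<in> graded_elem ` rep_families E" using neg by simp
next
  have "(\<lambda>n. 0) \<in> rep_families E" using kR.subspace_0[OF E(1)] by (simp add: rep_families_def)
  then show "\<one>\<^bsub>add_monoid A\<^esub> \<in> graded_elem ` rep_families E" by (simp add: graded_elem_zero)
next
  fix r u assume "r \<in> carrier A" "u \<in> graded_elem ` rep_families E"
  then obtain a b where a: "u = graded_elem a" "a \<in> rep_families E" and b: "r = graded_elem b" "b \<in> rep_families F"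
    by (auto simp: graded_elem_carrier)
  define c where "c = (\<lambda>n. \<Sum>i\<le>n. a i \<star> b (n - i))"
  have "a \<in> rep_families F" using a(2) E(2) by (auto simp: rep_families_def)
  then have "u \<otimes>\<^bsub>A\<^esub> r = graded_elem c" unfolding a(1) b(1) c_def using b(2) by (rule graded_elem_mult[OF fil])
  moreover have "c n \<in> E n" for n unfolding c_def
  proof (rule kR.subspace_sum[OF E(1)])
    fix i assume "i \<in> {..n}"
    then show "a i \<star> b (n - i) \<in> E n"
      using E_mult[of "a i" i "b (n - i)" "n - i"] a(2) b(2) by (simp add: rep_families_def)
  qed
  moreover have "finite {n. c n \<noteq> 0}"
  proof (rule finite_subset)
    show "{n. c n \<noteq> 0} \<subseteq> (\<lambda>(i, j). i + j) ` ({i. a i \<noteq> 0} \<times> {j. b j \<noteq> 0})"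
    proof
      fix n assume "n \<in> {n. c n \<noteq> 0}"
      then obtain i where i: "i \<le> n" "a i \<star> b (n - i) \<noteq> 0"
        unfolding c_def by (auto elim: sum.not_neutral_contains_not_neutral)
      then have "a i \<noteq> 0" "b (n - i) \<noteq> 0" using dmult_0 dmult_0_right by metis+
      then show "n \<in> (\<lambda>(i, j). i + j) ` ({i. a i \<noteq> 0} \<times> {j. b j \<noteq> 0})"
        using i(1) by (intro image_eqI[of _ _ "(i, n - i)"]) auto
    qed
    show "finite ((\<lambda>(i, j). i + j) ` ({i. a i \<noteq> 0} \<times> {j. b j \<noteq> 0}))"
      using a(2) b(2) by (auto simp: rep_families_def)
  qed
  ultimately show "u \<otimes>\<^bsub>A\<^esub> r \<in> graded_elem ` rep_families E" by (auto simp: rep_families_def)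
qed

lemma generated_upto_mult:
  assumes I: "\<And>i j g r. g \<in> I i \<Longrightarrow> r \<in> F j \<Longrightarrow> g \<star> r \<in> I (i + j)"
    and f: "f \<in> generated_upto (below F n) I N n" and r: "r \<in> F l"
  shows "f \<star> r \<in> generated_upto (below F (n + l)) I N (n + l)"
  using f unfolding generated_upto_def[of _ _ _ n]
proof (rule dmult_span[OF _ _ generated_upto_subspace])
  fix f assume "f \<in> below F n \<union> {g \<star> r |g r j. j \<le> N \<and> j \<le> n \<and> g \<in> I j \<and> r \<in> F (n - j)}"
  then consider "f \<in> below F n" | g s j where "f = g \<star> s" "j \<le> N" "j \<le> n" "g \<in> I j" "s \<in> F (n - j)" by blast
  then show "f \<star> r \<in> generated_upto (below F (n + l)) I N (n + l)"
  proof cases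
    case 1
    then show ?thesis using below_mult[OF filtered_module_F _ r] by (intro generated_upto_base)
  next
    case 2
    then have "s \<star> r \<in> F (n + l - j)" using F_mult[OF 2(5) r] by simp
    then have "g \<star> (s \<star> r) \<in> generated_upto (below F (n + l)) I N (n + l)" using 2 by (intro generated_upto_prod) auto
    then show ?thesis using 2(1) by (simp add: dmult_assoc)
  qed
qed

text \<open>
  The submodules generated by the components of degree at most \<open>N\<close> form an ascending chain of right ideals.  Where
  it becomes stationary, it contains the components of every degree \<open>n\<close>, as these belong to the \<open>n\<close>-th ideal.
\<close>

lemma right_noetherian_imp_gr_noetherian:
  assumes fil: "fd_filtration R k F" and noeth: "right_noetherian A"
  shows "gr_noetherian F"
  unfolding gr_noetherian_def
proof (intro allI impI)
  fix I assume I: "graded_submodule F I"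
  then have I_sub: "\<And>n. kR.subspace (I n)" and I_below: "\<And>n. below F n \<subseteq> I n" and I_F: "\<And>n. I n \<subseteq> F n"
    and I_mult: "\<And>i j g r. g \<in> I i \<Longrightarrow> r \<in> F j \<Longrightarrow> g \<star> r \<in> I (i + j)"
    unfolding graded_submodule_def by blast+
  define E where "E = (\<lambda>N n. generated_upto (below F n) I N n)"
  have E_F: "E N n \<subseteq> F n" for N n unfolding E_def
  proof (rule generated_upto_minimal[OF F_subspace below_subset[OF filtered_module_F]])
    fix j g r assume "j \<le> n" "g \<in> I j" "r \<in> F (n - j)"
    then show "g \<star> r \<in> F n" using I_F[of j] F_mult[of g j r "n - j"] by auto
  qed
  define Q where "Q = (\<lambda>N. graded_elem ` rep_families (E N))"
  have E_mult: "g \<star> r \<in> E N (i + j)" if "g \<in> E N i" "r \<in> F j" for N i j g r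
    using that unfolding E_def by (intro generated_upto_mult I_mult)
  have "right_ideal (Q N) A" for N unfolding Q_def
    by (rule graded_elem_right_ideal[OF fil _ E_F E_mult]) (simp add: E_def generated_upto_subspace)
  moreover have "E N n \<subseteq> E (Suc N) n" for N n unfolding E_def by (intro generated_upto_mono) auto
  then have "Q N \<subseteq> Q (Suc N)" for N unfolding Q_def rep_families_def by blast
  ultimately obtain N0 where N0: "\<And>N. N \<ge> N0 \<Longrightarrow> Q N = Q N0"
    using noeth unfolding right_noetherian_def ascending_chain_condition_def by meson
  show "\<exists>N. \<forall>n. I n \<subseteq> generated_upto (below F n) I N n"
  proof (intro exI[of _ N0] allI subsetI)
    fix n f assume f: "f \<in> I n"
    let ?N = "max n N0" and ?a = "\<lambda>i. if i = n then f else 0"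
    have "f \<star> 1 \<in> E ?N n" unfolding E_def
      by (rule generated_upto_prod[of n]) (use f F_one in auto)
    then have "f \<in> E ?N n" by (simp add: dmult_one)
    then have "?a \<in> rep_families (E ?N)" using kR.subspace_0[OF generated_upto_subspace] by (auto simp: rep_families_def E_def)
    then have "graded_elem ?a \<in> Q N0" using N0[of ?N] by (auto simp: Q_def)
    then obtain b where b: "b \<in> rep_families (E N0)" "graded_elem ?a = graded_elem b" by (auto simp: Q_def)
    have "f - b n \<in> below F n" using b(2)[unfolded graded_elem_eq_iff, rule_format, of n] by simp
    then have "f - b n \<in> E N0 n" unfolding E_def by (rule generated_upto_base)
    moreover have "b n \<in> E N0 n" using b(1) by (simp add: rep_families_def)
    ultimately have "(f - b n) + b n \<in> E N0 n" unfolding E_def by (rule kR.subspace_add[OF generated_upto_subspace])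
    then show "f \<in> generated_upto (below F n) I N0 n" by (simp add: E_def)
  qed
qed

end


section \<open>Infinite dimension over the p-th powers\<close>

lemma CHAR_rs_poly: "CHAR('p::prime_card rs_poly) = CARD('p)"
proof (rule CHAR_eqI)
  show "of_nat CARD('p) = (0 :: 'p rs_poly)" by (simp flip: single_of_nat)
  fix n assume "of_nat n = (0 :: 'p rs_poly)"
  then have "Poly_Mapping.lookup (of_nat n :: 'p rs_poly) 0 = 0" by simp
  then have "of_nat n = (0 :: 'p mod_ring)" by (simp add: lookup_of_nat)
  then show "CARD('p) dvd n" by (rule of_nat_0_mod_ring_dvd)
qed

lemma rs_emb_of_nat: "rs_emb (of_nat n :: 'p::prime_card rs_poly) = of_nat n"
  by (induction n) (simp_all add: rs_emb_0 rs_emb_1 rs_emb_add)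

lemma rs_emb_power: "rs_emb (f ^ n) = rs_emb f ^ n"
  by (induction n) (simp_all add: rs_emb_1 rs_emb_mult)

lemma rs_emb_sum: "rs_emb (sum f A) = (\<Sum>i\<in>A. rs_emb (f i))"
  by (induction A rule: infinite_finite_induct) (simp_all add: rs_emb_0 rs_emb_add)

lemma CHAR_rs_field: "CHAR('p::prime_card rs_field) = CARD('p)"
proof (rule CHAR_eqI)
  show "of_nat CARD('p) = (0 :: 'p rs_field)"
    unfolding rs_emb_of_nat[symmetric] rs_emb_eq_0 by (simp flip: CHAR_rs_poly)
  fix n assume "of_nat n = (0 :: 'p rs_field)"
  then have "of_nat n = (0 :: 'p rs_poly)" unfolding rs_emb_of_nat[symmetric] rs_emb_eq_0 .
  then show "CARD('p) dvd n" by (simp add: of_nat_eq_0_iff_char_dvd CHAR_rs_poly)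
qed

lemma frobenius_derivation_rs: "frobenius_derivation (rs_deriv :: 'p::prime_card rs_field \<Rightarrow> _) CARD('p)"
proof
  fix a b :: "'p rs_field"
  show "(a + b) ^ CARD('p) = a ^ CARD('p) + b ^ CARD('p)"
    by (rule freshmans_dream) (simp_all add: CHAR_rs_field prime_card)
qed (simp_all add: rs_deriv(1))

lemma single_power:
  "Poly_Mapping.single m c ^ n = Poly_Mapping.single (\<Sum>_<n. m) (c ^ n)"
  by (induction n) (simp_all add: mult_single add.commute)

lemma keys_power_CARD:
  fixes f :: "'p::prime_card rs_poly"
  assumes "m \<in> Poly_Mapping.keys (f ^ CARD('p))"
  shows "CARD('p) dvd Poly_Mapping.lookup m i"
proof -
  have "f ^ CARD('p) = (\<Sum>m\<in>Poly_Mapping.keys f. Poly_Mapping.single m (Poly_Mapping.lookup f m)) ^ CARD('p)"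
    by (simp only: rs_poly_expand)
  also have "\<dots> = (\<Sum>m\<in>Poly_Mapping.keys f. Poly_Mapping.single m (Poly_Mapping.lookup f m) ^ CARD('p))"
    by (rule freshmans_dream_sum) (simp_all add: CHAR_rs_poly prime_card)
  finally have "m \<in> Poly_Mapping.keys (\<Sum>m\<in>Poly_Mapping.keys f. Poly_Mapping.single (\<Sum>_<CARD('p). m) (Poly_Mapping.lookup f m ^ CARD('p)))"
    using assms by (simp only: single_power)
  then obtain m' where "m = (\<Sum>_<CARD('p). m')"
    using keys_sum[of "\<lambda>m. Poly_Mapping.single (\<Sum>_<CARD('p). m) (Poly_Mapping.lookup f m ^ CARD('p))" "Poly_Mapping.keys f"]
    by (fastforce split: if_splits)
  then show ?thesis by (simp only: lookup_sum) simp
qed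

text \<open>
  The exponents of the monomials of \<open>f\<^sub>i^p t\<^sub>i\<close> are divisible by \<open>p\<close>, except for the exponent of \<open>t\<^sub>i\<close>, which is
  \<open>1\<close> modulo \<open>p\<close>.  So no monomial occurs in two of the summands.
\<close>

lemma p_independent_poly:
  fixes f :: "nat \<Rightarrow> 'p::prime_card rs_poly"
  assumes "finite I" and z: "(\<Sum>i\<in>I. f i ^ CARD('p) * Poly_Mapping.single (Poly_Mapping.single i 1) 1) = 0" and j: "j \<in> I"
  shows "f j = 0"
proof (rule ccontr)
  let ?X = "\<lambda>i. Poly_Mapping.single (Poly_Mapping.single i 1) 1 :: 'p rs_poly"
  assume "f j \<noteq> 0"
  moreover have "?X j \<noteq> 0" by (metis lookup_single_eq lookup_zero one_neq_zero)
  ultimately have "f j ^ CARD('p) * ?X j \<noteq> 0" by simp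
  then obtain n where n: "n \<in> Poly_Mapping.keys (f j ^ CARD('p) * ?X j)"
    using keys_eq_empty[of "f j ^ CARD('p) * ?X j"] by blast
  have shape: "\<exists>a. n = a + Poly_Mapping.single i 1 \<and> (\<forall>l. CARD('p) dvd Poly_Mapping.lookup a l)"
    if "n \<in> Poly_Mapping.keys (f i ^ CARD('p) * ?X i)" for i
    using subsetD[OF keys_mult that] keys_power_CARD[of _ "f i"] by (auto split: if_splits)
  obtain a where a: "n = a + Poly_Mapping.single j 1" "\<And>l. CARD('p) dvd Poly_Mapping.lookup a l"
    using shape[OF n] by blast
  have "Poly_Mapping.lookup (f i ^ CARD('p) * ?X i) n = 0" if "i \<noteq> j" for i
  proof (rule ccontr)
    assume "Poly_Mapping.lookup (f i ^ CARD('p) * ?X i) n \<noteq> 0"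
    then obtain b where b: "n = b + Poly_Mapping.single i 1" "\<And>l. CARD('p) dvd Poly_Mapping.lookup b l"
      using shape[of i] by (auto simp: in_keys_iff)
    have "Poly_Mapping.lookup a i = Poly_Mapping.lookup b i + 1"
      using arg_cong[OF trans[OF a(1)[symmetric] b(1)], of "\<lambda>m. Poly_Mapping.lookup m i"] that
      by (simp add: lookup_add lookup_single when_def)
    then have "CARD('p) dvd 1" using a(2)[of i] b(2)[of i] by (metis dvd_add_right_iff)
    then show False using prime_card[where 'a='p] by (metis not_prime_unit)
  qed
  then have "(\<Sum>i\<in>I. Poly_Mapping.lookup (f i ^ CARD('p) * ?X i) n) = Poly_Mapping.lookup (f j ^ CARD('p) * ?X j) n"
    using \<open>finite I\<close> j by (subst sum.remove[of _ j]) (auto intro!: sum.neutral)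
  moreover have "(\<Sum>i\<in>I. Poly_Mapping.lookup (f i ^ CARD('p) * ?X i) n) = 0"
    using arg_cong[OF z, of "\<lambda>g. Poly_Mapping.lookup g n"] by (simp add: lookup_sum)
  ultimately show False using n by (simp add: in_keys_iff)
qed

lemma rs_common_denominator:
  fixes c :: "nat \<Rightarrow> 'p::prime_card rs_field"
  assumes "finite I"
  shows "\<exists>g f. g \<noteq> 0 \<and> (\<forall>i\<in>I. c i * rs_emb g = rs_emb (f i))"
  using assms
proof (induction I)
  case empty then show ?case by (intro exI[of _ 1]) auto
next
  case (insert j I)
  then obtain g f where gf: "g \<noteq> 0" "\<And>i. i \<in> I \<Longrightarrow> c i * rs_emb g = rs_emb (f i)" by blast
  obtain a b where ab: "b \<noteq> 0" "c j = rs_emb a / rs_emb b" by (cases "c j") (metis Fract_rs_emb)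
  then have "c j * rs_emb b = rs_emb a" by (simp add: rs_emb_eq_0)
  then have "c j * rs_emb (g * b) = rs_emb (a * g)" by (simp add: rs_emb_mult mult_ac)
  moreover have "c i * rs_emb (g * b) = rs_emb (f i * b)" if "i \<in> I" for i
    using gf(2)[OF that] by (simp add: rs_emb_mult flip: mult.assoc)
  ultimately show ?case using gf(1) ab(1)
    by (intro exI[of _ "g * b"] exI[of _ "\<lambda>i. if i = j then a * g else f i * b"]) auto
qed

lemma p_independent:
  fixes c :: "nat \<Rightarrow> 'p::prime_card rs_field"
  assumes I: "finite I" and z: "(\<Sum>i\<in>I. c i ^ CARD('p) * rs_var i) = 0" and j: "j \<in> I"
  shows "c j = 0"
proof -
  obtain g f where g: "g \<noteq> 0" and f: "\<And>i. i \<in> I \<Longrightarrow> c i * rs_emb g = rs_emb (f i)"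
    using rs_common_denominator[OF I, of c] by blast
  let ?X = "\<lambda>i. Poly_Mapping.single (Poly_Mapping.single i 1) 1 :: 'p rs_poly"
  have var: "rs_var i = rs_emb (?X i)" for i by (simp only: rs_var_def rs_emb_def)
  have "rs_emb (\<Sum>i\<in>I. f i ^ CARD('p) * ?X i) = (\<Sum>i\<in>I. (c i * rs_emb g) ^ CARD('p) * rs_var i)"
    unfolding rs_emb_sum by (intro sum.cong) (simp_all add: f rs_emb_mult rs_emb_power var)
  also have "\<dots> = rs_emb g ^ CARD('p) * (\<Sum>i\<in>I. c i ^ CARD('p) * rs_var i)"
    unfolding sum_distrib_left by (intro sum.cong) (simp_all add: power_mult_distrib mult_ac)
  finally have "rs_emb (\<Sum>i\<in>I. f i ^ CARD('p) * ?X i) = 0" by (simp add: z)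
  then have "f j = 0" using p_independent_poly[OF I _ j] by (simp add: rs_emb_eq_0)
  then show ?thesis using f[OF j] g by (simp add: rs_emb_0 rs_emb_eq_0)
qed

lemma rs_field_infinite_over_ground:
  assumes "finite S"
  shows "module.span (frobenius_derivation.field_scale CARD('p)) S \<noteq> (UNIV :: 'p::prime_card rs_field set)"
proof
  interpret frobenius_derivation "rs_deriv :: 'p rs_field \<Rightarrow> _" "CARD('p)" by (rule frobenius_derivation_rs)
  assume S: "kK.span S = UNIV"
  have inj: "inj (rs_var :: nat \<Rightarrow> 'p rs_field)"
  proof (rule injI, rule ccontr)
    fix i j assume ij: "rs_var i = (rs_var j :: 'p rs_field)" "i \<noteq> j"
    have "(1 + - 1 :: 'p rs_field) ^ CARD('p) = 1 ^ CARD('p) + (- 1) ^ CARD('p)" by (rule frob)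
    then have m1: "(- 1 :: 'p rs_field) ^ CARD('p) = - 1"
      by (simp add: power_0_left eq_neg_iff_add_eq_0 add.commute)
    have "(\<Sum>l\<in>{i, j}. (if l = i then 1 else - 1) ^ CARD('p) * rs_var l) = (0 :: 'p rs_field)"
      using ij by (simp add: m1)
    from p_independent[OF _ this, of i] show False by simp
  qed
  have "kK.independent (range rs_var)" unfolding kK.independent_explicit_module
  proof (intro allI impI)
    fix t u v assume t: "finite t" "t \<subseteq> range rs_var" "(\<Sum>v\<in>t. field_scale (u v) v) = 0" "v \<in> t"
    obtain I where I: "t = rs_var ` I" using t(2) by (auto simp: subset_image_iff)
    have "finite I" using t(1) I inj by (metis finite_imageD inj_on_subset subset_UNIV)
    have "(\<Sum>i\<in>I. u (rs_var i) ^ CARD('p) * rs_var i) = (\<Sum>v\<in>t. field_scale (u v) v)"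
      unfolding I by (subst sum.reindex) (auto simp: field_scale_def intro: inj_on_subset[OF inj])
    moreover obtain j where "j \<in> I" "v = rs_var j" using I t(4) by auto
    ultimately show "u v = 0" using p_independent[OF \<open>finite I\<close>, of "\<lambda>i. u (rs_var i)" j] t(3) by simp
  qed
  then have "finite (range (rs_var :: nat \<Rightarrow> 'p rs_field))"
    using kK.independent_span_bound[OF assms] S by auto
  then show False using inj by (metis finite_imageD infinite_UNIV_nat)
qed


section \<open>The Resco-Small algebra\<close>

theorem corollary1p2:
  shows "\<nexists>F :: nat \<Rightarrow> 'p::prime_card rs_field poly set.
           fd_filtration resco_small rs_base F \<and> noetherian (assoc_graded resco_small F)"
proof
  assume "\<exists>F :: nat \<Rightarrow> 'p rs_field poly set.
           fd_filtration resco_small rs_base F \<and> noetherian (assoc_graded resco_small F)"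
  then obtain F :: "nat \<Rightarrow> 'p rs_field poly set" where
    F: "fd_filtration resco_small rs_base F" "right_noetherian (assoc_graded resco_small F)"
    by (auto simp: noetherian_def)
  interpret frobenius_derivation "rs_deriv :: 'p rs_field \<Rightarrow> _" "CARD('p)" by (rule frobenius_derivation_rs)
  interpret diff_poly_filtration rs_deriv "CARD('p)" F
    using F(1) by (intro diff_poly_filtration_of_fd_filtration) (simp add: resco_small_def rs_base_def)
  have "gr_noetherian F"
    using F unfolding resco_small_def by (rule right_noetherian_imp_gr_noetherian)
  then obtain S where "finite S" "kK.span S = UNIV" using finite_over_ground by blast
  then show False using rs_field_infinite_over_ground by blast
qed

end
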